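(* Let $Z_i\subset\mathbb P^d$ be an irreducible subvariety of codimension $i$, for $1\le i\le d$. Let $p_1,\ldots,p_d,q\ge0$ be integers. Then $$h^0\Big(\mathbb P^d,\bigcap_{i=1}^d\mathcal I_{Z_i}^{(p_i)}\otimes\mathcal O_{\mathbb P^d}(q)\Big)\le\Big|\bigcap_{i=1}^d\{\alpha\in\mathbb N^{d+1}(q):\alpha_i+\cdots+\alpha_d\le q-p_i\}\Big|.$$ When $Z_1\supset Z_2\supset\cdots\supset Z_d$ is a linear flag in $\mathbb P^d$, the equality holds.
   Context: The ground field $k$ is algebraically closed of characteristic zero. $\mathcal I_Z^{(p)}$ denotes the $p$-th symbolic power of the ideal sheaf of $Z$; the space $\Gamma(\mathbb P^d,\bigcap_i\mathcal I_{Z_i}^{(p_i)}\otimes\mathcal O_{\mathbb P^d}(q))$ consists of the homogeneous polynomials $F$ of degree $q$ (including $0$) such that $F$ vanishes to order at least $p_i$ at every point of $Z_i$, for all $i$. $\mathbb N=\{0,1,2,\ldots\}$, and $\mathbb N^{d+1}(q)=\{\alpha=(\alpha_0,\ldots,\alpha_d)\in\mathbb N^{d+1}:\alpha_0+\cdots+\alpha_d=q\}$. $|A|$ is the cardinality of a finite set $A$. A linear flag is a flag of linear subspaces. *)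

theory Defs
  imports
    "HOL-Library.Poly_Mapping"
    "HOL-Library.Extended_Nat"
    "HOL-Computational_Algebra.Polynomial"
begin

section \<open>Polynomials\<close>

text \<open>
  Variables \<open>X\<^sub>0, X\<^sub>1, \<dots>\<close> are indexed by natural numbers; the polynomials in
  \<open>X\<^sub>0, \<dots>, X\<^sub>d\<close> are those all of whose monomials have keys in \<open>{..d}\<close>.
\<close>

type_synonym monomial = "nat \<Rightarrow>\<^sub>0 nat"
type_synonym 'k mpoly = "monomial \<Rightarrow>\<^sub>0 'k"

definition total_degree :: "monomial \<Rightarrow> nat" where
  "total_degree m = (\<Sum>i\<in>Poly_Mapping.keys m. Poly_Mapping.lookup m i)"

text \<open>The set \<open>\<nat>\<^bsup>d+1\<^esup>(q)\<close>.\<close>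

definition exponents :: "nat \<Rightarrow> nat \<Rightarrow> monomial set" where
  "exponents d q = {\<alpha>. Poly_Mapping.keys \<alpha> \<subseteq> {..d} \<and> (\<Sum>i\<le>d. Poly_Mapping.lookup \<alpha> i) = q}"

text \<open>Homogeneous polynomials of degree \<open>q\<close> in \<open>X\<^sub>0, \<dots>, X\<^sub>d\<close>, including \<open>0\<close>.\<close>

definition forms :: "nat \<Rightarrow> nat \<Rightarrow> 'k::zero mpoly set" where
  "forms d q = {F. Poly_Mapping.keys F \<subseteq> exponents d q}"

definition mpoly_const :: "'k::zero \<Rightarrow> 'k mpoly" where
  "mpoly_const c = Poly_Mapping.single 0 c"

definition mpoly_var :: "nat \<Rightarrow> 'k::zero_neq_one mpoly" where
  "mpoly_var i = Poly_Mapping.single (Poly_Mapping.single i 1) 1"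

text \<open>Substitution of \<open>\<sigma> i\<close> for \<open>X\<^sub>i\<close>, the coefficients being mapped by \<open>h\<close>.\<close>

definition mpoly_subst :: "('k::zero \<Rightarrow> 'r::comm_ring_1) \<Rightarrow> (nat \<Rightarrow> 'r) \<Rightarrow> 'k mpoly \<Rightarrow> 'r" where
  "mpoly_subst h \<sigma> F =
     (\<Sum>m\<in>Poly_Mapping.keys F. h (Poly_Mapping.lookup F m) *
        (\<Prod>i\<in>Poly_Mapping.keys m. \<sigma> i ^ Poly_Mapping.lookup m i))"

definition mpoly_eval :: "'k::comm_ring_1 mpoly \<Rightarrow> (nat \<Rightarrow> 'k) \<Rightarrow> 'k" where
  "mpoly_eval F v = mpoly_subst (\<lambda>c. c) v F"

definition mpoly_scale :: "'k::comm_ring_1 \<Rightarrow> 'k mpoly \<Rightarrow> 'k mpoly" where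
  "mpoly_scale c F = mpoly_const c * F"

global_interpretation mpoly: vector_space "mpoly_scale :: 'k::field \<Rightarrow> 'k mpoly \<Rightarrow> 'k mpoly"
proof
  fix a b :: 'k and x y :: "'k mpoly"
  show "mpoly_scale a (x + y) = mpoly_scale a x + mpoly_scale a y"
    by (simp add: mpoly_scale_def distrib_left)
  show "mpoly_scale (a + b) x = mpoly_scale a x + mpoly_scale b x"
    by (simp add: mpoly_scale_def mpoly_const_def single_add distrib_right)
  show "mpoly_scale a (mpoly_scale b x) = mpoly_scale (a * b) x"
    by (simp add: mpoly_scale_def mpoly_const_def mult_single mult.assoc [symmetric])
  show "mpoly_scale 1 x = x"
    by (simp add: mpoly_scale_def mpoly_const_def)
qed


section \<open>Projective space and its subvarieties\<close>

definition nonzero_vectors :: "nat \<Rightarrow> (nat \<Rightarrow> 'k::field) set" where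
  "nonzero_vectors d = {v. (\<forall>i>d. v i = 0) \<and> (\<exists>i\<le>d. v i \<noteq> 0)}"

definition proportional :: "nat \<Rightarrow> ((nat \<Rightarrow> 'k::field) \<times> (nat \<Rightarrow> 'k)) set" where
  "proportional d = {(v, w). v \<in> nonzero_vectors d \<and> w \<in> nonzero_vectors d \<and>
                             (\<exists>c. c \<noteq> 0 \<and> w = (\<lambda>i. c * v i))}"

text \<open>A point of \<open>\<P>\<^sup>d\<close> is the set of all its homogeneous coordinate vectors.\<close>

type_synonym 'k point = "(nat \<Rightarrow> 'k) set"

definition proj_space :: "nat \<Rightarrow> 'k::field point set" where
  "proj_space d = nonzero_vectors d // proportional d"

definition zero_locus :: "nat \<Rightarrow> 'k::field mpoly set \<Rightarrow> 'k point set" where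
  "zero_locus d S = {x \<in> proj_space d. \<forall>F\<in>S. \<forall>v\<in>x. mpoly_eval F v = 0}"

definition zariski_closed :: "nat \<Rightarrow> 'k::field point set \<Rightarrow> bool" where
  "zariski_closed d Z \<longleftrightarrow> (\<exists>S. S \<subseteq> (\<Union>n. forms d n) \<and> Z = zero_locus d S)"

definition irreducible_subvariety :: "nat \<Rightarrow> 'k::field point set \<Rightarrow> bool" where
  "irreducible_subvariety d Z \<longleftrightarrow>
     zariski_closed d Z \<and> Z \<noteq> {} \<and>
     (\<forall>A B. zariski_closed d A \<and> zariski_closed d B \<and> Z = A \<union> B \<longrightarrow> A = Z \<or> B = Z)"

text \<open>
  The codimension of an irreducible closed \<open>Z\<close> is the supremum of the lengths \<open>n\<close> of
  chains \<open>Z = Y\<^sub>0 \<subset> Y\<^sub>1 \<subset> \<dots> \<subset> Y\<^sub>n\<close> of irreducible closed subsets of \<open>\<P>\<^sup>d\<close>.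
\<close>

definition codimension :: "nat \<Rightarrow> 'k::field point set \<Rightarrow> enat" where
  "codimension d Z =
     (SUP n \<in> {n. \<exists>Y. Y 0 = Z \<and> (\<forall>i\<le>n. irreducible_subvariety d (Y i)) \<and>
                      (\<forall>i<n. Y i \<subset> Y (Suc i))}. enat n)"

definition linear_subspace :: "nat \<Rightarrow> 'k::field point set \<Rightarrow> bool" where
  "linear_subspace d L \<longleftrightarrow> (\<exists>S. S \<subseteq> forms d 1 \<and> L = zero_locus d S)"

definition linear_flag :: "nat \<Rightarrow> (nat \<Rightarrow> 'k::field point set) \<Rightarrow> bool" where
  "linear_flag d Z \<longleftrightarrow>
     (\<forall>i\<in>{1..d}. linear_subspace d (Z i)) \<and> (\<forall>i. 1 \<le> i \<and> i < d \<longrightarrow> Z (Suc i) \<subset> Z i)"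


section \<open>Order of vanishing\<close>

text \<open>
  In the affine chart \<open>X\<^sub>j \<noteq> 0\<close> with coordinates \<open>X\<^sub>i / X\<^sub>j\<close>, a form \<open>F\<close> of degree \<open>q\<close> is given
  by the function \<open>F / X\<^sub>j\<^sup>q\<close>, i.e.\ by \<open>F\<close> with \<open>X\<^sub>j\<close> replaced by \<open>1\<close>.  Its Taylor expansion at
  the point with homogeneous coordinates \<open>v\<close> is obtained by moving that point, whose affine
  coordinates are \<open>v i / v j\<close>, to the origin.
\<close>

definition chart_expansion :: "nat \<Rightarrow> (nat \<Rightarrow> 'k::field) \<Rightarrow> 'k mpoly \<Rightarrow> 'k mpoly" where
  "chart_expansion j v F =
     mpoly_subst mpoly_const
       (\<lambda>i. if i = j then 1 else mpoly_var i + mpoly_const (v i / v j)) F"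

text \<open>
  The germ of \<open>F\<close> at the point \<open>x\<close> lies in the \<open>p\<close>-th power of the maximal ideal at \<open>x\<close>
  iff its expansion has no term of degree \<open>< p\<close>.  This does not depend on the chart or on \<open>v\<close>;
  it is required here in every chart containing \<open>x\<close>.
\<close>

definition vanishes_to_order :: "'k::field mpoly \<Rightarrow> nat \<Rightarrow> 'k point \<Rightarrow> bool" where
  "vanishes_to_order F p x \<longleftrightarrow>
     (\<forall>v\<in>x. \<forall>j. v j \<noteq> 0 \<longrightarrow>
        (\<forall>m\<in>Poly_Mapping.keys (chart_expansion j v F). p \<le> total_degree m))"

text \<open>
  The space \<open>\<Gamma>(\<P>\<^sup>d, \<Inter>\<^sub>i \<I>\<^bsub>Z\<^sub>i\<^esub>\<^bsup>(p\<^sub>i)\<^esup> \<otimes> \<O>(q))\<close>.  It is contained in the finite-dimensional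
  space \<open>forms d q\<close>, so the convention that \<open>dim\<close> is \<open>0\<close> on infinite-dimensional spaces
  does not intervene in \<open>h0\<close>.
\<close>

definition sections ::
  "nat \<Rightarrow> (nat \<Rightarrow> 'k::field point set) \<Rightarrow> (nat \<Rightarrow> nat) \<Rightarrow> nat \<Rightarrow> 'k mpoly set" where
  "sections d Z p q = {F \<in> forms d q. \<forall>i\<in>{1..d}. \<forall>x\<in>Z i. vanishes_to_order F (p i) x}"

definition h0 :: "nat \<Rightarrow> (nat \<Rightarrow> 'k::field point set) \<Rightarrow> (nat \<Rightarrow> nat) \<Rightarrow> nat \<Rightarrow> nat" where
  "h0 d Z p q = mpoly.dim (sections d Z p q)"

end

theory Submission
  imports Defs "HOL-Library.Function_Algebras" "HOL-Library.FuncSet"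
begin

text \<open>
  For \<open>\<alpha>\<close> of total degree \<open>q\<close> the condition \<open>\<alpha>\<^sub>i + \<dots> + \<alpha>\<^sub>d \<le> q - p\<^sub>i\<close> says that
  \<open>\<alpha>\<^sub>0 + \<dots> + \<alpha>\<^bsub>i-1\<^esub> \<ge> p\<^sub>i\<close>.  The theorem is proved by showing that the leading exponents of
  sections, taken in coordinates in general position, satisfy these inequalities.

  Choose vectors \<open>e\<^sub>0, \<dots>, e\<^sub>d\<close> in general position.  Starting from a nonzero section \<open>F\<^sub>0 = F\<close>,
  let \<open>\<alpha>\<^sub>s\<close> be the degree of \<open>F\<^sub>s(X + t e\<^sub>s)\<close> in \<open>t\<close> and \<open>F\<^bsub>s+1\<^esub>\<close> its leading coefficient
  (\<open>leading_exponent\<close>).  Then \<open>F\<^sub>s\<close> is a nonzero form of degree \<open>q - (\<alpha>\<^sub>0 + \<dots> + \<alpha>\<^bsub>s-1\<^esub>)\<close> that is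
  invariant under translation by \<open>e\<^sub>0, \<dots>, e\<^bsub>s-1\<^esub>\<close>.  Passing from \<open>F\<close> to \<open>F\<^sub>s\<close> lowers the order
  of vanishing at any point by at most \<open>\<alpha>\<^sub>0 + \<dots> + \<alpha>\<^bsub>s-1\<^esub>\<close> (\<open>hasse_order_on_lines\<close>).  Hence, if
  \<open>\<alpha>\<^sub>0 + \<dots> + \<alpha>\<^bsub>i-1\<^esub> < p\<^sub>i\<close>, the form \<open>F\<^sub>i\<close> vanishes on \<open>Z\<^sub>i\<close> and, being invariant, on the join of
  \<open>Z\<^sub>i\<close> with the span of \<open>e\<^sub>0, \<dots>, e\<^bsub>i-1\<^esub>\<close>.  That join is dense in \<open>\<P>\<^sup>d\<close>, so \<open>F\<^sub>i = 0\<close>, a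
  contradiction.

  The density (\<open>iterated_join_dense\<close>) is where the codimension enters.  Joining an irreducible
  set with a point outside its closure gives an irreducible set with strictly larger closure, so
  if \<open>i\<close> joins did not fill \<open>\<P>\<^sup>d\<close>, one more would produce a chain of length \<open>i + 1\<close> of
  irreducible closed sets above \<open>Z\<^sub>i\<close>.

  Finally the value of \<open>F\<^sub>d\<close> at \<open>e\<^sub>d\<close> is nonzero.  So the linear functionals that send \<open>F\<close> to
  the value at \<open>e\<^sub>d\<close> of its iterated Taylor coefficient of index \<open>\<alpha>\<close>, for \<open>\<alpha>\<close> satisfying the
  inequalities, separate the space of sections, and its dimension is at most their number.

  For a linear flag there are linear forms \<open>l\<^sub>0, \<dots>, l\<^sub>d\<close> such that \<open>l\<^sub>0, \<dots>, l\<^bsub>i-1\<^esub>\<close> vanish on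
  \<open>Z\<^sub>i\<close> and that are linearly independent for triangularity reasons
  (\<open>linear_flag_equations\<close>, \<open>triangular_forms_surjective\<close>).  The products \<open>l\<^sup>\<alpha>\<close>, with \<open>\<alpha>\<close>
  satisfying the inequalities, are then linearly independent sections.
\<close>

section \<open>Substitution is a ring homomorphism\<close>

definition ring_homomorphism :: "('a::comm_ring_1 \<Rightarrow> 'b::comm_ring_1) \<Rightarrow> bool" where
  "ring_homomorphism h \<longleftrightarrow> h 0 = 0 \<and> h 1 = 1 \<and>
     (\<forall>a b. h (a + b) = h a + h b) \<and> (\<forall>a b. h (a * b) = h a * h b)"

lemma ring_homomorphismD:
  assumes "ring_homomorphism h"
  shows "h 0 = 0" "h 1 = 1" "h (a + b) = h a + h b" "h (a * b) = h a * h b"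
  using assms by (auto simp: ring_homomorphism_def)

lemma ring_homomorphism_power: "ring_homomorphism h \<Longrightarrow> h (a ^ n) = h a ^ n"
  by (induction n) (simp_all add: ring_homomorphismD)

lemma ring_homomorphism_sum: "ring_homomorphism h \<Longrightarrow> h (\<Sum>i\<in>A. f i) = (\<Sum>i\<in>A. h (f i))"
  by (induction A rule: infinite_finite_induct) (simp_all add: ring_homomorphismD)

lemma ring_homomorphism_prod: "ring_homomorphism h \<Longrightarrow> h (\<Prod>i\<in>A. f i) = (\<Prod>i\<in>A. h (f i))"
  by (induction A rule: infinite_finite_induct) (simp_all add: ring_homomorphismD)

lemma ring_homomorphism_comp:
  "ring_homomorphism g \<Longrightarrow> ring_homomorphism h \<Longrightarrow> ring_homomorphism (\<lambda>x. g (h x))"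
  by (simp add: ring_homomorphism_def)

lemma ring_homomorphism_id: "ring_homomorphism (\<lambda>x. x)"
  by (simp add: ring_homomorphism_def)

lemma ring_homomorphism_mpoly_const: "ring_homomorphism mpoly_const"
  by (simp add: ring_homomorphism_def mpoly_const_def single_add mult_single)

lemma ring_homomorphism_poly_const: "ring_homomorphism (\<lambda>c. [:c:])"
  by (simp add: ring_homomorphism_def)

lemma ring_homomorphism_poly: "ring_homomorphism (\<lambda>p. poly p t)"
  by (simp add: ring_homomorphism_def)

lemma ring_homomorphism_map_poly:
  assumes h: "ring_homomorphism h"
  shows "ring_homomorphism (map_poly h)"
proof -
  have [simp]: "coeff (map_poly h p) n = h (coeff p n)" for p n
    by (rule coeff_map_poly) (rule ring_homomorphismD[OF h])
  show ?thesis
    unfolding ring_homomorphism_def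
    by (auto intro!: poly_eqI simp: ring_homomorphismD[OF h] coeff_mult ring_homomorphism_sum[OF h]
        coeff_pCons one_pCons split: nat.splits)
qed

definition monomial_value :: "(nat \<Rightarrow> 'r::comm_ring_1) \<Rightarrow> monomial \<Rightarrow> 'r" where
  "monomial_value \<sigma> m = (\<Prod>i\<in>Poly_Mapping.keys m. \<sigma> i ^ Poly_Mapping.lookup m i)"

lemma monomial_value_superset:
  assumes "finite S" "Poly_Mapping.keys m \<subseteq> S"
  shows "monomial_value \<sigma> m = (\<Prod>i\<in>S. \<sigma> i ^ Poly_Mapping.lookup m i)"
  unfolding monomial_value_def using assms
  by (intro prod.mono_neutral_left) (auto simp: in_keys_iff)

lemma monomial_value_0 [simp]: "monomial_value \<sigma> 0 = 1"
  by (simp add: monomial_value_def)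

lemma monomial_value_add: "monomial_value \<sigma> (m + n) = monomial_value \<sigma> m * monomial_value \<sigma> n"
proof -
  let ?S = "Poly_Mapping.keys m \<union> Poly_Mapping.keys n"
  have "monomial_value \<sigma> (m + n) = (\<Prod>i\<in>?S. \<sigma> i ^ Poly_Mapping.lookup (m + n) i)"
    by (rule monomial_value_superset) (simp_all add: keys_add)
  also have "\<dots> = (\<Prod>i\<in>?S. \<sigma> i ^ Poly_Mapping.lookup m i) * (\<Prod>i\<in>?S. \<sigma> i ^ Poly_Mapping.lookup n i)"
    by (simp add: lookup_add power_add prod.distrib)
  also have "\<dots> = monomial_value \<sigma> m * monomial_value \<sigma> n"
    by (simp add: monomial_value_superset[where S = ?S])
  finally show ?thesis .
qed

lemma mpoly_subst_altdef:
  "mpoly_subst h \<sigma> F =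
     (\<Sum>m\<in>Poly_Mapping.keys F. h (Poly_Mapping.lookup F m) * monomial_value \<sigma> m)"
  by (simp add: mpoly_subst_def monomial_value_def)

lemma mpoly_subst_superset:
  assumes "h 0 = 0" "finite S" "Poly_Mapping.keys F \<subseteq> S"
  shows "mpoly_subst h \<sigma> F = (\<Sum>m\<in>S. h (Poly_Mapping.lookup F m) * monomial_value \<sigma> m)"
  unfolding mpoly_subst_altdef using assms
  by (intro sum.mono_neutral_left) (auto simp: in_keys_iff)

lemma mpoly_subst_0 [simp]: "mpoly_subst h \<sigma> 0 = 0"
  by (simp add: mpoly_subst_def)

lemma mpoly_subst_single:
  assumes "h 0 = 0"
  shows "mpoly_subst h \<sigma> (Poly_Mapping.single m c) = h c * monomial_value \<sigma> m"
  using mpoly_subst_superset[of h "{m}" "Poly_Mapping.single m c" \<sigma>] assms by simp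

lemma mpoly_subst_const: "ring_homomorphism h \<Longrightarrow> mpoly_subst h \<sigma> (mpoly_const c) = h c"
  by (simp add: mpoly_const_def mpoly_subst_single ring_homomorphismD)

lemma mpoly_subst_var: "ring_homomorphism h \<Longrightarrow> mpoly_subst h \<sigma> (mpoly_var i) = \<sigma> i"
  by (simp add: mpoly_var_def mpoly_subst_single ring_homomorphismD monomial_value_def)

lemma mpoly_subst_add:
  assumes "ring_homomorphism h"
  shows "mpoly_subst h \<sigma> (F + G) = mpoly_subst h \<sigma> F + mpoly_subst h \<sigma> G"
proof -
  let ?S = "Poly_Mapping.keys F \<union> Poly_Mapping.keys G"
  have "mpoly_subst h \<sigma> (F + G)
      = (\<Sum>m\<in>?S. h (Poly_Mapping.lookup (F + G) m) * monomial_value \<sigma> m)"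
    using assms by (intro mpoly_subst_superset) (auto simp: ring_homomorphismD keys_add)
  also have "\<dots> = mpoly_subst h \<sigma> F + mpoly_subst h \<sigma> G"
    using assms by (simp add: mpoly_subst_superset[where S = ?S] lookup_add ring_homomorphismD
        distrib_right sum.distrib)
  finally show ?thesis .
qed

lemma mpoly_subst_sum:
  assumes "ring_homomorphism h"
  shows "mpoly_subst h \<sigma> (\<Sum>i\<in>A. f i) = (\<Sum>i\<in>A. mpoly_subst h \<sigma> (f i))"
  by (induction A rule: infinite_finite_induct) (simp_all add: mpoly_subst_add assms)

lemma mpoly_eq_sum_monomials:
  fixes F :: "'k::comm_ring_1 mpoly"
  shows "F = (\<Sum>m\<in>Poly_Mapping.keys F. Poly_Mapping.single m (Poly_Mapping.lookup F m))"
proof (rule poly_mapping_eqI)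
  fix n
  have "(\<Sum>m\<in>Poly_Mapping.keys F. Poly_Mapping.lookup (Poly_Mapping.single m (Poly_Mapping.lookup F m)) n)
     = (\<Sum>m\<in>Poly_Mapping.keys F. if m = n then Poly_Mapping.lookup F n else 0)"
    by (intro sum.cong) (auto simp: lookup_single)
  also have "\<dots> = Poly_Mapping.lookup F n"
    by (simp add: sum.delta in_keys_iff)
  finally show "Poly_Mapping.lookup F n = Poly_Mapping.lookup
      (\<Sum>m\<in>Poly_Mapping.keys F. Poly_Mapping.single m (Poly_Mapping.lookup F m)) n"
    by (simp add: lookup_sum)
qed

lemma mpoly_subst_mult:
  assumes h: "ring_homomorphism h"
  shows "mpoly_subst h \<sigma> (F * G) = mpoly_subst h \<sigma> F * mpoly_subst h \<sigma> G"
proof -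
  let ?s = "\<lambda>F m. Poly_Mapping.single m (Poly_Mapping.lookup F m)"
  let ?K = "Poly_Mapping.keys"
  have "F * G = (\<Sum>m\<in>?K F. ?s F m) * (\<Sum>m\<in>?K G. ?s G m)"
    using mpoly_eq_sum_monomials by metis
  also have "mpoly_subst h \<sigma> \<dots> = (\<Sum>m\<in>?K F. \<Sum>n\<in>?K G. mpoly_subst h \<sigma> (?s F m * ?s G n))"
    by (simp add: sum_product mpoly_subst_sum h)
  also have "\<dots> = (\<Sum>m\<in>?K F. \<Sum>n\<in>?K G. (h (Poly_Mapping.lookup F m) * monomial_value \<sigma> m) *
                     (h (Poly_Mapping.lookup G n) * monomial_value \<sigma> n))"
    by (intro sum.cong) (simp_all add: mult_single mpoly_subst_single ring_homomorphismD[OF h]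
        monomial_value_add mult_ac)
  also have "\<dots> = mpoly_subst h \<sigma> F * mpoly_subst h \<sigma> G"
    by (simp add: mpoly_subst_altdef sum_product)
  finally show ?thesis .
qed

lemma ring_homomorphism_mpoly_subst:
  assumes "ring_homomorphism h"
  shows "ring_homomorphism (mpoly_subst h \<sigma>)"
proof -
  have "mpoly_subst h \<sigma> 1 = 1"
    using mpoly_subst_const[OF assms, of \<sigma> 1] assms by (simp add: ring_homomorphismD mpoly_const_def)
  then show ?thesis
    using assms by (simp add: ring_homomorphism_def[of "mpoly_subst h \<sigma>"] mpoly_subst_add mpoly_subst_mult)
qed

text \<open>
  Two homomorphisms out of a polynomial ring are compared through this lemma: postcomposing a
  substitution with \<open>g\<close> is again a substitution, so only the images of constants and variables
  have to be matched.
\<close>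

lemma hom_mpoly_subst:
  assumes "ring_homomorphism g"
  shows "g (mpoly_subst h \<sigma> F) = mpoly_subst (\<lambda>c. g (h c)) (\<lambda>i. g (\<sigma> i)) F"
  by (simp add: mpoly_subst_altdef monomial_value_def ring_homomorphism_sum[OF assms]
      ring_homomorphism_prod[OF assms] ring_homomorphism_power[OF assms] ring_homomorphismD[OF assms])

lemma mpoly_subst_cong_vars:
  assumes "\<And>m i. m \<in> Poly_Mapping.keys F \<Longrightarrow> i \<in> Poly_Mapping.keys m \<Longrightarrow> \<sigma> i = \<tau> i"
  shows "mpoly_subst h \<sigma> F = mpoly_subst h \<tau> F"
  unfolding mpoly_subst_def using assms by (intro sum.cong arg_cong2[where f = "(*)"] prod.cong) auto

lemma ring_homomorphism_eval: "ring_homomorphism (\<lambda>F. mpoly_eval F v)"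
  unfolding mpoly_eval_def by (rule ring_homomorphism_mpoly_subst[OF ring_homomorphism_id])

lemmas mpoly_eval_hom [simp] = ring_homomorphismD[OF ring_homomorphism_eval]

lemma mpoly_eval_const [simp]: "mpoly_eval (mpoly_const c) v = c"
  by (simp add: mpoly_eval_def mpoly_subst_const ring_homomorphism_id)

lemma mpoly_eval_var [simp]: "mpoly_eval (mpoly_var i) v = v i"
  by (simp add: mpoly_eval_def mpoly_subst_var ring_homomorphism_id)

lemma mpoly_eval_subst:
  "mpoly_eval (mpoly_subst mpoly_const \<sigma> F) v = mpoly_eval F (\<lambda>i. mpoly_eval (\<sigma> i) v)"
  using hom_mpoly_subst[OF ring_homomorphism_eval, where h = mpoly_const]
  by (simp add: mpoly_eval_def[of F])


section \<open>Forms\<close>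

definition supported :: "nat \<Rightarrow> (nat \<Rightarrow> 'k::zero) \<Rightarrow> bool" where
  "supported d v \<longleftrightarrow> (\<forall>i>d. v i = 0)"

lemma exponents_add:
  assumes "\<alpha> \<in> exponents d m" "\<beta> \<in> exponents d n"
  shows "\<alpha> + \<beta> \<in> exponents d (m + n)"
  using assms keys_add[of \<alpha> \<beta>]
  by (auto simp: exponents_def lookup_add sum.distrib)

lemma total_degree_exponents: "\<alpha> \<in> exponents d n \<Longrightarrow> total_degree \<alpha> = n"
proof -
  assume *: "\<alpha> \<in> exponents d n"
  then have "total_degree \<alpha> = (\<Sum>i\<le>d. Poly_Mapping.lookup \<alpha> i)"
    unfolding total_degree_def exponents_def
    by (intro sum.mono_neutral_left) (auto simp: in_keys_iff)
  then show ?thesis using * by (simp add: exponents_def)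
qed

lemma zero_in_forms [simp]: "0 \<in> forms d n"
  by (simp add: forms_def)

lemma forms_add: "F \<in> forms d n \<Longrightarrow> G \<in> forms d n \<Longrightarrow> F + G \<in> forms d n"
  using keys_add[of F G] by (auto simp: forms_def)

lemma forms_mult:
  assumes "F \<in> forms d m" "G \<in> forms d n"
  shows "F * G \<in> forms d (m + n)"
  using assms keys_mult[of F G] exponents_add unfolding forms_def by fastforce

lemma forms_const: "mpoly_const c \<in> forms d 0"
  by (simp add: forms_def mpoly_const_def exponents_def)

lemma one_in_forms: "(1 :: 'k::comm_ring_1 mpoly) \<in> forms d 0"
  using forms_const[of "1::'k" d] by (simp add: mpoly_const_def)

lemma forms_var: "i \<le> d \<Longrightarrow> mpoly_var i \<in> forms d 1"
  by (auto simp: forms_def mpoly_var_def exponents_def lookup_single when_def)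

lemma forms_scale: "F \<in> forms d n \<Longrightarrow> mpoly_scale c F \<in> forms d n"
  using forms_mult[OF forms_const, of F d n c] by (simp add: mpoly_scale_def)

text \<open>
  The sets \<open>G n\<close> may be the forms of degree \<open>n\<close>, the polynomials in \<open>t\<close> over \<open>k[X]\<close> whose
  coefficient of \<open>t\<^sup>a\<close> is a form of degree \<open>n - a\<close>, or the powers of the ideal of the origin.  In
  all three cases the location of a product of substituted elements follows from the weights of
  its factors alone.
\<close>

definition multiplicative_grading :: "(nat \<Rightarrow> 'r::comm_ring_1 set) \<Rightarrow> bool" where
  "multiplicative_grading G \<longleftrightarrow> (\<forall>n. 0 \<in> G n) \<and> (\<forall>n. \<forall>a\<in>G n. \<forall>b\<in>G n. a + b \<in> G n) \<and>
     1 \<in> G 0 \<and> (\<forall>m n. \<forall>a\<in>G m. \<forall>b\<in>G n. a * b \<in> G (m + n))"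

lemma multiplicative_gradingD:
  assumes "multiplicative_grading G"
  shows "0 \<in> G n" "a \<in> G n \<Longrightarrow> b \<in> G n \<Longrightarrow> a + b \<in> G n" "1 \<in> G 0"
    "a \<in> G m \<Longrightarrow> b \<in> G n \<Longrightarrow> a * b \<in> G (m + n)"
  using assms by (auto simp: multiplicative_grading_def)

lemma grading_sum:
  "multiplicative_grading G \<Longrightarrow> (\<And>i. i \<in> A \<Longrightarrow> f i \<in> G n) \<Longrightarrow> (\<Sum>i\<in>A. f i) \<in> G n"
  by (induction A rule: infinite_finite_induct) (auto intro: multiplicative_gradingD)

lemma grading_power: "multiplicative_grading G \<Longrightarrow> a \<in> G m \<Longrightarrow> a ^ n \<in> G (n * m)"
  by (induction n) (auto intro: multiplicative_gradingD)

lemma grading_prod: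
  "multiplicative_grading G \<Longrightarrow> (\<And>i. i \<in> A \<Longrightarrow> f i \<in> G (n i)) \<Longrightarrow> (\<Prod>i\<in>A. f i) \<in> G (\<Sum>i\<in>A. n i)"
  by (induction A rule: infinite_finite_induct) (auto intro: multiplicative_gradingD)

lemma grading_monomial_value:
  assumes G: "multiplicative_grading G" and m: "m \<in> exponents d n" and \<sigma>: "\<And>i. i \<le> d \<Longrightarrow> \<sigma> i \<in> G (w i)"
  shows "monomial_value \<sigma> m \<in> G (\<Sum>i\<le>d. Poly_Mapping.lookup m i * w i)"
proof -
  have "(\<Prod>i\<le>d. \<sigma> i ^ Poly_Mapping.lookup m i) \<in> G (\<Sum>i\<le>d. Poly_Mapping.lookup m i * w i)"
    using \<sigma> by (intro grading_prod[OF G] grading_power[OF G]) auto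
  moreover have "monomial_value \<sigma> m = (\<Prod>i\<le>d. \<sigma> i ^ Poly_Mapping.lookup m i)"
    using m by (intro monomial_value_superset) (auto simp: exponents_def)
  ultimately show ?thesis by simp
qed

lemma grading_subst:
  assumes G: "multiplicative_grading G" and F: "F \<in> forms d n"
    and h: "\<And>c. h c \<in> G 0" and \<sigma>: "\<And>i. i \<le> d \<Longrightarrow> \<sigma> i \<in> G 1"
  shows "mpoly_subst h \<sigma> F \<in> G n"
  unfolding mpoly_subst_altdef
proof (rule grading_sum[OF G])
  fix m assume "m \<in> Poly_Mapping.keys F"
  then have "m \<in> exponents d n" using F by (auto simp: forms_def)
  then have "monomial_value \<sigma> m \<in> G n"
    using grading_monomial_value[OF G, of m d n \<sigma> "\<lambda>_. 1"] \<sigma> by (simp add: exponents_def)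
  then show "h (Poly_Mapping.lookup F m) * monomial_value \<sigma> m \<in> G n"
    using multiplicative_gradingD(4)[OF G h] by fastforce
qed

lemma grading_forms: "multiplicative_grading (forms d :: nat \<Rightarrow> 'k::comm_ring_1 mpoly set)"
  by (auto simp: multiplicative_grading_def forms_add one_in_forms forms_mult)

lemmas forms_sum = grading_sum[OF grading_forms]

lemma subst_linear_in_forms:
  assumes "F \<in> forms d n" "\<And>i. i \<le> d \<Longrightarrow> \<sigma> i \<in> forms d 1"
  shows "mpoly_subst mpoly_const \<sigma> F \<in> forms d n"
  using assms by (intro grading_subst[OF grading_forms] forms_const)

lemma monomial_value_scale:
  "monomial_value (\<lambda>i. c * v i) m = c ^ total_degree m * monomial_value v m"
  by (simp add: monomial_value_def power_mult_distrib prod.distrib total_degree_def power_sum)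

lemma eval_homogeneous:
  assumes "F \<in> forms d n"
  shows "mpoly_eval F (\<lambda>i. c * v i) = c ^ n * mpoly_eval F v"
proof -
  have "total_degree m = n" if "m \<in> Poly_Mapping.keys F" for m
    using that assms total_degree_exponents by (auto simp: forms_def)
  then show ?thesis
    by (simp add: mpoly_eval_def mpoly_subst_altdef monomial_value_scale sum_distrib_left algebra_simps)
qed

text \<open>
  A polynomial over an infinite field is determined by its values: freezing all but one variable
  and comparing coefficients of the last one reduces the number of variables.
\<close>

lemma monomials_independent_as_functions:
  fixes c :: "monomial \<Rightarrow> 'k::field_char_0"
  assumes "finite S" "\<And>m. m \<in> S \<Longrightarrow> Poly_Mapping.keys m \<subseteq> {..<n}"
    and "\<And>v. (\<forall>i\<ge>n. v i = 0) \<Longrightarrow> (\<Sum>m\<in>S. c m * (\<Prod>i<n. v i ^ Poly_Mapping.lookup m i)) = 0"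
    and "m \<in> S"
  shows "c m = 0"
  using assms
proof (induction n arbitrary: S c m)
  case 0
  have "S = {m}"
    using 0 by (auto simp: keys_eq_empty)
  then show ?case using 0(3)[of "\<lambda>_. 0"] by simp
next
  case (Suc n)
  let ?l = "Poly_Mapping.lookup"
  define b where "b = ?l m n"
  define T where "T = {m'\<in>S. ?l m' n = b}"
  define cut where "cut m' = m' - Poly_Mapping.single n (?l m' n)" for m' :: monomial
  have l_cut: "?l (cut m') i = (if i = n then 0 else ?l m' i)" for m' i
    by (simp add: cut_def lookup_minus lookup_single when_def)
  have cut_eq: "m' = cut m' + Poly_Mapping.single n (?l m' n)" for m'
    by (rule poly_mapping_eqI) (simp add: l_cut lookup_add lookup_single when_def)
  have inj: "inj_on cut T"
  proof (rule inj_onI)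
    fix x y assume "x \<in> T" "y \<in> T" "cut x = cut y"
    then show "x = y"
      using cut_eq[of x] cut_eq[of y] by (simp add: T_def)
  qed
  have zero: "(\<Sum>m'\<in>T. c m' * (\<Prod>i<n. v i ^ ?l m' i)) = 0" if v: "\<forall>i\<ge>n. v i = 0" for v
  proof -
    define P where "P = (\<Sum>m'\<in>S. monom (c m' * (\<Prod>i<n. v i ^ ?l m' i)) (?l m' n))"
    have "poly P t = 0" for t
    proof -
      have "poly P t = (\<Sum>m'\<in>S. c m' * (\<Prod>i<Suc n. (v(n := t)) i ^ ?l m' i))"
        by (auto simp: P_def poly_sum poly_monom mult_ac intro!: sum.cong prod.cong)
      also have "\<dots> = 0"
        using v by (intro Suc.prems(3)) auto
      finally show ?thesis .
    qed
    then have "P = 0"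
      by (metis poly_all_0_iff_0)
    then have "coeff P b = 0" by simp
    then show ?thesis
      unfolding P_def T_def using Suc.prems(1)
      by (simp add: coeff_sum sum.inter_filter)
  qed
  have "c (inv_into T cut (cut m)) = 0"
  proof (rule Suc.IH[where S = "cut ` T" and c = "\<lambda>m'. c (inv_into T cut m')"])
    show "finite (cut ` T)" using Suc.prems(1) by (simp add: T_def)
    show "cut m \<in> cut ` T" using Suc.prems(4) by (simp add: T_def b_def)
    show "Poly_Mapping.keys m' \<subseteq> {..<n}" if "m' \<in> cut ` T" for m'
    proof -
      from that obtain m'' where m'': "m'' \<in> S" "m' = cut m''" by (auto simp: T_def)
      then show ?thesis
        using Suc.prems(2)[OF m''(1)] by (auto simp: in_keys_iff l_cut subset_iff less_Suc_eq split: if_splits)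
    qed
    show "(\<Sum>m'\<in>cut ` T. c (inv_into T cut m') * (\<Prod>i<n. v i ^ ?l m' i)) = 0"
      if "\<forall>i\<ge>n. v i = 0" for v
    proof -
      have "(\<Sum>m'\<in>cut ` T. c (inv_into T cut m') * (\<Prod>i<n. v i ^ ?l m' i))
          = (\<Sum>m'\<in>T. c m' * (\<Prod>i<n. v i ^ ?l m' i))"
        using inj by (subst sum.reindex) (auto simp: l_cut intro!: sum.cong prod.cong)
      then show ?thesis using zero[OF that] by simp
    qed
  qed
  moreover have "inv_into T cut (cut m) = m"
    using inj Suc.prems(4) by (intro inv_into_f_f) (auto simp: T_def b_def)
  ultimately show ?case by simp
qed

lemma form_eq_0I:
  fixes F :: "'k::field_char_0 mpoly"
  assumes F: "F \<in> forms d n" and "\<And>v. supported d v \<Longrightarrow> mpoly_eval F v = 0"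
  shows "F = 0"
proof (rule poly_mapping_eqI)
  fix m
  have "Poly_Mapping.lookup F m = 0" if "m \<in> Poly_Mapping.keys F"
  proof (rule monomials_independent_as_functions[where S = "Poly_Mapping.keys F" and n = "Suc d"])
    show keys: "Poly_Mapping.keys m \<subseteq> {..<Suc d}" if "m \<in> Poly_Mapping.keys F" for m
      using F that by (force simp: forms_def exponents_def)
    fix v :: "nat \<Rightarrow> 'k" assume "\<forall>i\<ge>Suc d. v i = 0"
    then have "mpoly_eval F v = 0"
      by (intro assms(2)) (auto simp: supported_def)
    moreover have "mpoly_eval F v = (\<Sum>m\<in>Poly_Mapping.keys F. Poly_Mapping.lookup F m *
                                       (\<Prod>i<Suc d. v i ^ Poly_Mapping.lookup m i))"
      unfolding mpoly_eval_def mpoly_subst_altdef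
      by (intro sum.cong refl arg_cong2[where f = "(*)"] monomial_value_superset keys) auto
    ultimately show "(\<Sum>m\<in>Poly_Mapping.keys F. Poly_Mapping.lookup F m *
                                       (\<Prod>i<Suc d. v i ^ Poly_Mapping.lookup m i)) = 0"
      by simp
  qed (use that in auto)
  then show "Poly_Mapping.lookup F m = Poly_Mapping.lookup 0 m"
    by (auto simp: in_keys_iff)
qed

section \<open>Restriction to lines\<close>

definition line :: "'k::comm_ring_1 mpoly \<Rightarrow> (nat \<Rightarrow> 'k) \<Rightarrow> (nat \<Rightarrow> 'k) \<Rightarrow> 'k poly" where
  "line F x u = mpoly_subst (\<lambda>c. [:c:]) (\<lambda>i. [:x i, u i:]) F"

lemma poly_line: "poly (line F x u) t = mpoly_eval F (\<lambda>i. x i + t * u i)"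
  unfolding line_def mpoly_eval_def by (simp add: hom_mpoly_subst[OF ring_homomorphism_poly])

lemma poly_eq_0_if_infinite_zeros:
  fixes p :: "'k::idom poly"
  assumes "infinite {t. poly p t = 0}"
  shows "p = 0"
  using assms poly_roots_finite by blast

lemma poly_eq_0_if_zero_off_finite:
  fixes p :: "'k::field_char_0 poly"
  assumes "finite A" "\<And>t. t \<notin> A \<Longrightarrow> poly p t = 0"
  shows "p = 0"
proof (rule poly_eq_0_if_infinite_zeros)
  have "infinite (UNIV - A)" using assms(1) infinite_UNIV_char_0 by (rule Diff_infinite_finite)
  moreover have "UNIV - A \<subseteq> {t. poly p t = 0}" using assms(2) by auto
  ultimately show "infinite {t. poly p t = 0}" using finite_subset by blast
qed


section \<open>Irreducible sets of coordinate vectors\<close>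

lemma nonzero_vectorsI: "supported d v \<Longrightarrow> v i \<noteq> 0 \<Longrightarrow> v \<in> nonzero_vectors d"
  by (auto simp: supported_def nonzero_vectors_def not_le[symmetric])

lemma nonzero_vectors_supported: "v \<in> nonzero_vectors d \<Longrightarrow> supported d v"
  by (auto simp: supported_def nonzero_vectors_def)

lemma proj_space_class:
  assumes "v \<in> nonzero_vectors d"
  shows "proportional d `` {v} \<in> proj_space d" "v \<in> proportional d `` {v}"
proof -
  have "\<exists>c. c \<noteq> 0 \<and> v = (\<lambda>i. c * v i)" by (rule exI[of _ 1]) simp
  then show "v \<in> proportional d `` {v}" using assms by (auto simp: proportional_def)
qed (use assms in \<open>auto simp: proj_space_def intro: quotientI\<close>)

lemma proj_space_nonempty: "x \<in> proj_space d \<Longrightarrow> \<exists>v. v \<in> x"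
  unfolding proj_space_def by (metis quotientE proj_space_class(2))

lemma proj_space_nonzero: "x \<in> proj_space d \<Longrightarrow> v \<in> x \<Longrightarrow> v \<in> nonzero_vectors d"
  unfolding proj_space_def by (auto elim!: quotientE simp: proportional_def)

lemma proj_space_proportional:
  assumes "x \<in> proj_space d" "v \<in> x" "w \<in> x"
  shows "\<exists>c. c \<noteq> 0 \<and> w = (\<lambda>i. c * v i)"
proof -
  obtain u where "x = proportional d `` {u}"
    using assms(1) unfolding proj_space_def by (auto elim: quotientE)
  with assms(2,3) obtain a b where "a \<noteq> 0" "v = (\<lambda>i. a * u i)" "b \<noteq> 0" "w = (\<lambda>i. b * u i)"
    by (auto simp: proportional_def)
  then show ?thesis by (intro exI[of _ "b / a"]) auto
qed

lemma form_vanishes_on_point: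
  assumes "x \<in> proj_space d" "v \<in> x" "w \<in> x" "F \<in> forms d n" "mpoly_eval F v = 0"
  shows "mpoly_eval F w = 0"
proof -
  obtain c where "w = (\<lambda>i. c * v i)" using proj_space_proportional[OF assms(1-3)] by auto
  then show ?thesis using eval_homogeneous[OF assms(4), of c v] assms(5) by simp
qed

definition vanishing_forms :: "nat \<Rightarrow> (nat \<Rightarrow> 'k::field) set \<Rightarrow> 'k mpoly set" where
  "vanishing_forms d C = {F. (\<exists>n. F \<in> forms d n) \<and> (\<forall>v\<in>C. mpoly_eval F v = 0)}"

definition projective_closure :: "nat \<Rightarrow> (nat \<Rightarrow> 'k::field) set \<Rightarrow> 'k point set" where
  "projective_closure d C = zero_locus d (vanishing_forms d C)"

text \<open>
  The homogeneous ideal of \<open>C\<close> is prime.  Only forms are tested, as they are what cuts out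
  closed subsets of projective space.
\<close>

definition irreducible_vectors :: "nat \<Rightarrow> (nat \<Rightarrow> 'k::field) set \<Rightarrow> bool" where
  "irreducible_vectors d C \<longleftrightarrow>
     (\<forall>m n. \<forall>F\<in>forms d m. \<forall>G\<in>forms d n. (\<forall>v\<in>C. mpoly_eval F v * mpoly_eval G v = 0) \<longrightarrow>
        (\<forall>v\<in>C. mpoly_eval F v = 0) \<or> (\<forall>v\<in>C. mpoly_eval G v = 0))"

lemma irreducible_vectorsD:
  assumes "irreducible_vectors d C" "F \<in> forms d m" "G \<in> forms d n"
    and "v \<in> C" "mpoly_eval F v \<noteq> 0" "w \<in> C" "mpoly_eval G w \<noteq> 0"
  shows "\<exists>y\<in>C. mpoly_eval F y \<noteq> 0 \<and> mpoly_eval G y \<noteq> 0"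
proof (rule ccontr)
  assume "\<not> ?thesis"
  then have "\<forall>v\<in>C. mpoly_eval F v * mpoly_eval G v = 0" by auto
  then have "(\<forall>v\<in>C. mpoly_eval F v = 0) \<or> (\<forall>v\<in>C. mpoly_eval G v = 0)"
    using assms(1-3) unfolding irreducible_vectors_def by blast
  then show False using assms(4-7) by blast
qed

lemma zariski_closed_zero_locus: "S \<subseteq> (\<Union>n. forms d n) \<Longrightarrow> zariski_closed d (zero_locus d S)"
  by (auto simp: zariski_closed_def)

lemma irreducible_subvariety_vectors:
  assumes "irreducible_subvariety d Z"
  shows "irreducible_vectors d (\<Union>Z)"
  unfolding irreducible_vectors_def
proof (intro allI ballI impI)
  fix m n F G
  assume F: "F \<in> forms d m" and G: "G \<in> forms d n"
    and FG: "\<forall>v\<in>\<Union>Z. mpoly_eval F v * mpoly_eval G v = 0"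
  obtain S where S: "S \<subseteq> (\<Union>n. forms d n)" "Z = zero_locus d S"
    using assms by (auto simp: irreducible_subvariety_def zariski_closed_def)
  define A where "A = zero_locus d (insert F S)"
  define B where "B = zero_locus d (insert G S)"
  have "zariski_closed d A" "zariski_closed d B"
    using S F G unfolding A_def B_def by (auto intro!: zariski_closed_zero_locus)
  moreover have "Z = A \<union> B"
  proof
    show "Z \<subseteq> A \<union> B"
    proof
      fix x assume x: "x \<in> Z"
      then have xp: "x \<in> proj_space d" using S by (auto simp: zero_locus_def)
      then obtain v where v: "v \<in> x" using proj_space_nonempty by auto
      then have "mpoly_eval F v = 0 \<or> mpoly_eval G v = 0" using FG x by auto
      then show "x \<in> A \<union> B"
        using form_vanishes_on_point[OF xp v] F G x S
        by (auto simp: A_def B_def zero_locus_def)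
    qed
  qed (auto simp: A_def B_def S zero_locus_def)
  ultimately have "A = Z \<or> B = Z"
    using assms by (auto simp: irreducible_subvariety_def)
  then show "(\<forall>v\<in>\<Union>Z. mpoly_eval F v = 0) \<or> (\<forall>v\<in>\<Union>Z. mpoly_eval G v = 0)"
    by (auto simp: A_def B_def zero_locus_def)
qed

lemma projective_closure_memI:
  assumes "v \<in> C" "v \<in> nonzero_vectors d"
  shows "proportional d `` {v} \<in> projective_closure d C"
  using proj_space_class[OF assms(2)] form_vanishes_on_point[OF proj_space_class[OF assms(2)]] assms(1)
  unfolding projective_closure_def zero_locus_def vanishing_forms_def by blast

text \<open>
  If two proper closed subsets covered the closure, forms that vanish on one of them but not on
  \<open>C\<close> would have a product that vanishes on \<open>C\<close>.
\<close>

lemma projective_closure_irreducible: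
  assumes C: "irreducible_vectors d C" and v0: "v0 \<in> C" "v0 \<in> nonzero_vectors d"
    and supp: "\<And>v. v \<in> C \<Longrightarrow> supported d v"
  shows "irreducible_subvariety d (projective_closure d C)"
  unfolding irreducible_subvariety_def
proof (intro conjI allI impI)
  let ?Y = "projective_closure d C"
  show "zariski_closed d ?Y"
    unfolding projective_closure_def
    by (intro zariski_closed_zero_locus) (auto simp: vanishing_forms_def)
  show "?Y \<noteq> {}" using projective_closure_memI[OF v0] by auto
  fix A B assume AB: "zariski_closed d A \<and> zariski_closed d B \<and> ?Y = A \<union> B"
  have separate: "\<exists>F n. F \<in> forms d n \<and> (\<forall>x\<in>A. \<forall>v\<in>x. mpoly_eval F v = 0) \<and> (\<exists>v\<in>C. mpoly_eval F v \<noteq> 0)"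
    if A: "zariski_closed d A" "A \<subseteq> ?Y" "A \<noteq> ?Y" for A
  proof -
    obtain S where S: "S \<subseteq> (\<Union>n. forms d n)" "A = zero_locus d S"
      using A(1) by (auto simp: zariski_closed_def)
    obtain x where x: "x \<in> ?Y" "x \<notin> A" using A by auto
    then obtain F v where F: "F \<in> S" "v \<in> x" "mpoly_eval F v \<noteq> 0"
      using S by (auto simp: zero_locus_def projective_closure_def)
    then have "F \<notin> vanishing_forms d C"
      using x by (auto simp: projective_closure_def zero_locus_def)
    moreover obtain n where "F \<in> forms d n" using F S by auto
    ultimately show ?thesis
      using F S unfolding vanishing_forms_def zero_locus_def by blast
  qed
  show "A = ?Y \<or> B = ?Y"
  proof (rule ccontr)
    assume neg: "\<not> (A = ?Y \<or> B = ?Y)"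
    obtain F m v where F: "F \<in> forms d m" "\<forall>x\<in>A. \<forall>v\<in>x. mpoly_eval F v = 0" "v \<in> C" "mpoly_eval F v \<noteq> 0"
      using separate[of A] AB neg by auto
    obtain G n w where G: "G \<in> forms d n" "\<forall>x\<in>B. \<forall>v\<in>x. mpoly_eval G v = 0" "w \<in> C" "mpoly_eval G w \<noteq> 0"
      using separate[of B] AB neg by auto
    obtain l where l: "l \<le> d" "v0 l \<noteq> 0" using v0 by (auto simp: nonzero_vectors_def)
    obtain y where y: "y \<in> C" "mpoly_eval F y \<noteq> 0" "mpoly_eval G y \<noteq> 0"
      using irreducible_vectorsD[OF C F(1) G(1) F(3,4) G(3,4)] by auto
    \<comment> \<open>The factor \<open>X\<^sub>l\<close> keeps the common nonzero of \<open>F\<close> and \<open>G\<close> away from the origin.\<close>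
    obtain u where u: "u \<in> C" "mpoly_eval (F * G) u \<noteq> 0" "mpoly_eval (mpoly_var l) u \<noteq> 0"
      using irreducible_vectorsD[OF C forms_mult[OF F(1) G(1)] forms_var[OF l(1)], of y v0] y v0 l
      by auto
    then have "u \<in> nonzero_vectors d" using supp nonzero_vectorsI by auto
    then have "proportional d `` {u} \<in> A \<union> B" "u \<in> proportional d `` {u}"
      using projective_closure_memI u AB proj_space_class by blast+
    then show False using F(2) G(2) u by auto
  qed
qed

lemma projective_closure_of_closed:
  assumes "zariski_closed d Z"
  shows "projective_closure d (\<Union>Z) = Z"
proof -
  obtain S where S: "S \<subseteq> (\<Union>n. forms d n)" "Z = zero_locus d S"
    using assms by (auto simp: zariski_closed_def)
  have "S \<subseteq> vanishing_forms d (\<Union>Z)"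
    unfolding vanishing_forms_def S(2) zero_locus_def using S(1) by blast
  then have "projective_closure d (\<Union>Z) \<subseteq> Z"
    unfolding S(2) projective_closure_def zero_locus_def by blast
  moreover have "Z \<subseteq> projective_closure d (\<Union>Z)"
    unfolding S(2) projective_closure_def zero_locus_def vanishing_forms_def by blast
  ultimately show ?thesis by blast
qed


section \<open>Joining an irreducible set with points\<close>

text \<open>
  The closure of \<open>join_step m u C\<close> is the join of \<open>C\<close> with the point \<open>u\<close>, provided that the
  coordinate \<open>X\<^sub>m\<close> does not vanish on \<open>C\<close>.  The factor \<open>y m\<close> makes \<open>y \<mapsto> y + c y\<^sub>m u\<close>
  a linear map, so that forms pull back to forms.
\<close>

definition join_step :: "nat \<Rightarrow> (nat \<Rightarrow> 'k::field) \<Rightarrow> (nat \<Rightarrow> 'k) set \<Rightarrow> (nat \<Rightarrow> 'k) set" where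
  "join_step m u C = {\<lambda>i. y i + c * y m * u i | y c. y \<in> C}"

lemma join_step_subset: "C \<subseteq> join_step m u C"
proof
  fix y assume "y \<in> C"
  moreover have "y = (\<lambda>i. y i + 0 * y m * u i)" by simp
  ultimately show "y \<in> join_step m u C" unfolding join_step_def by blast
qed

text \<open>
  For every \<open>c\<close> one of the two pullbacks along \<open>y \<mapsto> y + c y\<^sub>m u\<close> vanishes on \<open>C\<close>, so the same
  one does for infinitely many \<open>c\<close>; being polynomial in \<open>c\<close>, it vanishes for all of them.
\<close>

lemma join_step_irreducible:
  fixes C :: "(nat \<Rightarrow> 'k::field_char_0) set"
  assumes C: "irreducible_vectors d C" and m: "m \<le> d"
  shows "irreducible_vectors d (join_step m u C)"
  unfolding irreducible_vectors_def
proof (intro allI ballI impI)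
  fix k n and F G :: "'k mpoly"
  assume F: "F \<in> forms d k" and G: "G \<in> forms d n"
    and FG: "\<forall>v\<in>join_step m u C. mpoly_eval F v * mpoly_eval G v = 0"
  define pullback where "pullback c F = mpoly_subst mpoly_const
      (\<lambda>i. mpoly_var i + mpoly_const (c * u i) * mpoly_var m) F" for c and F :: "'k mpoly"
  have ev: "mpoly_eval (pullback c F) y = mpoly_eval F (\<lambda>i. y i + c * y m * u i)" for c F y
    by (simp add: pullback_def mpoly_eval_subst mult_ac)
  have form: "pullback c F \<in> forms d n" if "F \<in> forms d n" for c F n
    unfolding pullback_def using forms_mult[OF forms_const forms_var[OF m]]
    by (intro subst_linear_in_forms[OF that] forms_add forms_var) simp_all
  define zeros where "zeros F = {c. \<forall>y\<in>C. mpoly_eval (pullback c F) y = 0}" for F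
  have "c \<in> zeros F \<union> zeros G" for c
  proof -
    have "\<forall>y\<in>C. mpoly_eval (pullback c F) y * mpoly_eval (pullback c G) y = 0"
      unfolding ev using FG by (auto simp: join_step_def)
    then show ?thesis
      using C form[OF F, of c] form[OF G, of c] unfolding irreducible_vectors_def zeros_def by blast
  qed
  then have "zeros F \<union> zeros G = UNIV" by auto
  then have inf: "infinite (zeros F) \<or> infinite (zeros G)"
    by (metis finite_Un infinite_UNIV_char_0)
  have conclude: "\<forall>v\<in>join_step m u C. mpoly_eval F v = 0" if inf: "infinite (zeros F)" for F
  proof
    fix v assume "v \<in> join_step m u C"
    then obtain y c where y: "y \<in> C" "v = (\<lambda>i. y i + c * y m * u i)" by (auto simp: join_step_def)
    define P where "P = line F y (\<lambda>i. y m * u i)"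
    have P: "poly P c = mpoly_eval F (\<lambda>i. y i + c * y m * u i)" for c
      by (simp add: P_def poly_line mult_ac)
    have "zeros F \<subseteq> {c. poly P c = 0}" using y by (auto simp: zeros_def ev P)
    then have "P = 0" using inf finite_subset poly_eq_0_if_infinite_zeros by blast
    then show "mpoly_eval F v = 0" using P[of c] y by simp
  qed
  show "(\<forall>v\<in>join_step m u C. mpoly_eval F v = 0) \<or> (\<forall>v\<in>join_step m u C. mpoly_eval G v = 0)"
    using inf conclude by auto
qed

text \<open>
  The closure of the join contains \<open>u\<close>: the form \<open>F\<close> vanishes at \<open>y\<^sub>m u + t y\<close> for all
  \<open>t \<noteq> 0\<close>, hence at \<open>y\<^sub>m u\<close>.
\<close>

lemma join_step_vanishing_at_vertex:
  fixes C :: "(nat \<Rightarrow> 'k::field_char_0) set"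
  assumes F: "F \<in> forms d n" and van: "\<forall>v\<in>join_step m u C. mpoly_eval F v = 0"
    and y: "y \<in> C" "y m \<noteq> 0"
  shows "mpoly_eval F u = 0"
proof -
  define P where "P = line F (\<lambda>i. y m * u i) y"
  have "P = 0"
  proof (rule poly_eq_0_if_zero_off_finite[where A = "{0}"])
    fix t :: 'k assume "t \<notin> {0}"
    then have t: "t \<noteq> 0" by simp
    have "(\<lambda>i. y m * u i + t * y i) = (\<lambda>i. t * (y i + inverse t * y m * u i))"
      using t by (intro ext) (simp add: distrib_left mult.assoc[symmetric])
    then have "poly P t = mpoly_eval F (\<lambda>i. t * (y i + inverse t * y m * u i))"
      by (simp add: P_def poly_line)
    also have "\<dots> = t ^ n * mpoly_eval F (\<lambda>i. y i + inverse t * y m * u i)"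
      by (rule eval_homogeneous[OF F])
    also have "\<dots> = 0" using van y by (auto simp: join_step_def)
    finally show "poly P t = 0" .
  qed simp
  then have "poly P 0 = 0" by simp
  then have "y m ^ n * mpoly_eval F u = 0"
    by (simp add: P_def poly_line eval_homogeneous[OF F])
  then show ?thesis using y by simp
qed

text \<open>
  A form vanishing on \<open>C\<close> but not at \<open>u\<close> cannot vanish on the join, whose closure contains \<open>u\<close>;
  so the closure grows.
\<close>

lemma projective_closure_join_step_psubset:
  fixes C :: "(nat \<Rightarrow> 'k::field_char_0) set"
  assumes F: "F \<in> forms d n" and van: "\<forall>v\<in>C. mpoly_eval F v = 0" and "mpoly_eval F u \<noteq> 0"
    and y: "y \<in> C" "y m \<noteq> 0" and supp: "\<And>v. v \<in> C \<Longrightarrow> supported d v" "supported d u"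
  shows "projective_closure d C \<subset> projective_closure d (join_step m u C)"
proof
  show "projective_closure d C \<subseteq> projective_closure d (join_step m u C)"
    using join_step_subset[of C m u]
    by (fastforce simp: projective_closure_def zero_locus_def vanishing_forms_def)
  obtain v where v: "v \<in> join_step m u C" "mpoly_eval F v \<noteq> 0"
    using join_step_vanishing_at_vertex[OF F _ y, of u] assms(3) by auto
  have "v \<in> nonzero_vectors d"
  proof (rule ccontr)
    assume "v \<notin> nonzero_vectors d"
    moreover have "supported d v" using v supp by (auto simp: join_step_def supported_def)
    ultimately have "v = (\<lambda>i. 0 * y i)" using nonzero_vectorsI by fastforce
    then have "mpoly_eval F v = 0 ^ n * mpoly_eval F y" using eval_homogeneous[OF F] by metis
    then show False using v van y by simp
  qed
  then have "proportional d `` {v} \<in> projective_closure d (join_step m u C)" "v \<in> proportional d `` {v}"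
    using v projective_closure_memI proj_space_class by blast+
  moreover have "F \<in> vanishing_forms d C" using F van by (auto simp: vanishing_forms_def)
  then have "proportional d `` {v} \<notin> projective_closure d C"
    unfolding projective_closure_def zero_locus_def using calculation(2) v(2) by blast
  ultimately show "projective_closure d C \<noteq> projective_closure d (join_step m u C)" by blast
qed

fun iterated_join :: "nat \<Rightarrow> (nat \<Rightarrow> nat \<Rightarrow> 'k::field) \<Rightarrow> (nat \<Rightarrow> 'k) set \<Rightarrow> nat \<Rightarrow> (nat \<Rightarrow> 'k) set" where
  "iterated_join m e C 0 = C"
| "iterated_join m e C (Suc s) = join_step m (e s) (iterated_join m e C s)"

lemma iterated_join_cong:
  "(\<And>l. l < s \<Longrightarrow> e l = e' l) \<Longrightarrow> iterated_join m e C s = iterated_join m e' C s"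
  by (induction s) auto

lemma iterated_join_mono: "s \<le> t \<Longrightarrow> iterated_join m e C s \<subseteq> iterated_join m e C t"
  by (induction t) (auto simp: le_Suc_eq intro: subsetD[OF join_step_subset])

lemma iterated_join_supported:
  assumes "\<And>v. v \<in> C \<Longrightarrow> supported d v" "\<And>l. l < s \<Longrightarrow> supported d (e l)" "v \<in> iterated_join m e C s"
  shows "supported d v"
  using assms(2,3)
  by (induction s arbitrary: v) (use assms(1) in \<open>auto simp: join_step_def supported_def less_Suc_eq\<close>)

lemma iterated_join_irreducible:
  fixes C :: "(nat \<Rightarrow> 'k::field_char_0) set"
  shows "irreducible_vectors d C \<Longrightarrow> m \<le> d \<Longrightarrow> irreducible_vectors d (iterated_join m e C s)"
  by (induction s) (auto intro: join_step_irreducible)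

text \<open>
  As long as the iterated join of
  \<open>Z\<close> with the points \<open>e 0, e 1, \<dots>\<close> is not dense, joining with the next point strictly enlarges
  its closure.  If it still were not dense after \<open>i\<close> points, the closures would form a chain of
  length \<open>i + 1\<close> above \<open>Z\<close>.
\<close>

lemma iterated_join_dense:
  fixes Z :: "'k::field_char_0 point set"
  assumes Z: "irreducible_subvariety d Z" and codim: "codimension d Z = enat i"
    and m: "m \<le> d" and z: "z \<in> \<Union>Z" "z m \<noteq> 0"
    and e: "\<And>s. s \<le> i \<Longrightarrow> supported d (e s)"
    and avoid: "\<And>s F n. s \<le> i \<Longrightarrow> F \<in> forms d n \<Longrightarrow> F \<noteq> 0 \<Longrightarrow>
         \<forall>v\<in>iterated_join m e (\<Union>Z) s. mpoly_eval F v = 0 \<Longrightarrow>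
         \<exists>F n. F \<in> forms d n \<and> (\<forall>v\<in>iterated_join m e (\<Union>Z) s. mpoly_eval F v = 0) \<and> mpoly_eval F (e s) \<noteq> 0"
    and F: "F \<in> forms d n" "\<forall>v\<in>iterated_join m e (\<Union>Z) i. mpoly_eval F v = 0"
  shows "F = 0"
proof (rule ccontr)
  assume "F \<noteq> 0"
  let ?C = "iterated_join m e (\<Union>Z)"
  define Y where "Y s = projective_closure d (?C s)" for s
  have Zp: "x \<in> Z \<Longrightarrow> x \<in> proj_space d" for x
    using Z by (auto simp: irreducible_subvariety_def zariski_closed_def zero_locus_def)
  have supp0: "supported d v" if "v \<in> \<Union>Z" for v
    using that Zp proj_space_nonzero nonzero_vectors_supported by blast
  have supp: "supported d v" if "v \<in> ?C s" "s \<le> Suc i" for v s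
    using iterated_join_supported[OF supp0 _ that(1)] e that(2) by auto
  have zC: "z \<in> ?C s" for s using iterated_join_mono[of 0 s m e "\<Union>Z"] z by auto
  have irr: "irreducible_subvariety d (Y s)" if "s \<le> Suc i" for s
    unfolding Y_def
    using iterated_join_irreducible[OF irreducible_subvariety_vectors[OF Z] m] zC supp that
      nonzero_vectorsI[OF supp0[OF z(1)] z(2)]
    by (intro projective_closure_irreducible[where ?v0.0 = z]) auto
  have "Y s \<subset> Y (Suc s)" if s: "s < Suc i" for s
  proof -
    have "\<forall>v\<in>?C s. mpoly_eval F v = 0"
      using F(2) iterated_join_mono[of s i m e "\<Union>Z"] s by auto
    then obtain G k where "G \<in> forms d k" "\<forall>v\<in>?C s. mpoly_eval G v = 0" "mpoly_eval G (e s) \<noteq> 0"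
      using avoid[of s F n] s F(1) \<open>F \<noteq> 0\<close> by auto
    then show ?thesis
      unfolding Y_def iterated_join.simps using zC z(2) supp e s
    by (intro projective_closure_join_step_psubset[where F = G and y = z]) auto
  qed
  moreover have "Y 0 = Z"
    using Z by (auto simp: Y_def irreducible_subvariety_def projective_closure_of_closed)
  ultimately have "enat (Suc i) \<le> codimension d Z"
    unfolding codimension_def using irr by (intro SUP_upper) (auto intro!: exI[of _ Y])
  then show False using codim by simp
qed

section \<open>Points in general position\<close>

definition vec_scale :: "'k::field \<Rightarrow> (nat \<Rightarrow> 'k) \<Rightarrow> nat \<Rightarrow> 'k" where
  "vec_scale c v = (\<lambda>i. c * v i)"

global_interpretation vec: vector_space "vec_scale :: 'k::field \<Rightarrow> (nat \<Rightarrow> 'k) \<Rightarrow> nat \<Rightarrow> 'k"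
  by standard (auto simp: vec_scale_def algebra_simps)

lemma sum_fun_apply: "(\<Sum>i\<in>A. f i) x = (\<Sum>i\<in>A. f i x)"
  by (induction A rule: infinite_finite_induct) auto

definition unit_vector :: "nat \<Rightarrow> nat \<Rightarrow> 'k::field" where
  "unit_vector j = (\<lambda>i. if i = j then 1 else 0)"

lemma unit_vector_inj: "inj_on unit_vector A"
  by (rule inj_onI) (auto simp: unit_vector_def fun_eq_iff split: if_splits)

lemma unit_vectors_independent: "vec.independent (unit_vector ` {..d} :: (nat \<Rightarrow> 'k::field) set)"
proof (rule vec.independent_if_scalars_zero)
  fix f :: "(nat \<Rightarrow> 'k) \<Rightarrow> 'k" and x :: "nat \<Rightarrow> 'k"
  assume sum: "(\<Sum>x\<in>unit_vector ` {..d}. vec_scale (f x) x) = 0" and "x \<in> unit_vector ` {..d}"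
  then obtain j where j: "j \<le> d" "x = unit_vector j" by auto
  have "0 = (\<Sum>x\<in>unit_vector ` {..d}. vec_scale (f x) x) j" by (simp add: sum)
  also have "\<dots> = (\<Sum>i\<le>d. f (unit_vector i) * unit_vector i j)"
    by (simp add: sum_fun_apply sum.reindex[OF unit_vector_inj] vec_scale_def)
  also have "\<dots> = (\<Sum>i\<le>d. if i = j then f (unit_vector j) else 0)"
    by (intro sum.cong) (auto simp: unit_vector_def)
  also have "\<dots> = f x" using j by simp
  finally show "f x = 0" by simp
qed simp

lemma supported_in_span_units:
  assumes "supported d v"
  shows "v \<in> vec.span (unit_vector ` {..d})"
proof -
  have "v i = (\<Sum>j\<le>d. v j * unit_vector j i)" for i
  proof -
    have "(\<Sum>j\<le>d. v j * unit_vector j i) = (\<Sum>j\<le>d. if j = i then v i else 0)"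
      by (intro sum.cong) (auto simp: unit_vector_def)
    then show ?thesis using assms by (auto simp: supported_def)
  qed
  from this[symmetric] have "v = (\<Sum>j\<le>d. vec_scale (v j) (unit_vector j))"
    by (intro ext) (simp add: sum_fun_apply vec_scale_def)
  also have "\<dots> \<in> vec.span (unit_vector ` {..d})"
    by (intro vec.span_sum vec.span_scale vec.span_base) auto
  finally show ?thesis .
qed

lemma unit_vector_outside_span:
  fixes A :: "(nat \<Rightarrow> 'k::field) set"
  assumes "finite A" "card A \<le> d"
  shows "\<exists>j\<le>d. unit_vector j \<notin> vec.span A"
proof (rule ccontr)
  assume "\<not> ?thesis"
  then have "card (unit_vector ` {..d} :: (nat \<Rightarrow> 'k) set) \<le> card A"
    using vec.independent_span_bound[OF assms(1) unit_vectors_independent[of d]] by auto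
  then show False using assms(2) by (simp add: card_image[OF unit_vector_inj])
qed

text \<open>
  Being chosen successively outside the span of their predecessors, the \<open>d + 1\<close> vectors are
  independent, so another vector outside their span would give \<open>d + 2\<close> independent vectors in a
  space generated by \<open>d + 1\<close> unit vectors.
\<close>

lemma span_of_vectors_in_general_position:
  fixes e :: "nat \<Rightarrow> nat \<Rightarrow> 'k::field"
  assumes supp: "\<And>s. s \<le> d \<Longrightarrow> supported d (e s)"
    and indep: "\<And>s. s \<le> d \<Longrightarrow> e s \<notin> vec.span (e ` {..<s})"
    and x: "supported d x"
  shows "\<exists>c. x = (\<lambda>i. \<Sum>s\<le>d. c s * e s i)"
proof -
  have "vec.independent (e ` {..<s}) \<and> inj_on e {..<s}" if "s \<le> Suc d" for s
    using that
  proof (induction s)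
    case (Suc s)
    then have "e s \<notin> vec.span (e ` {..<s})" "vec.independent (e ` {..<s})" "inj_on e {..<s}"
      using indep by auto
    moreover from this(1) have "e s \<notin> e ` {..<s}" by (metis vec.span_base)
    ultimately show ?case
      by (simp add: lessThan_Suc vec.independent_insertI)
  qed (simp add: vec.independent_empty)
  from this[of "Suc d"] have ind: "vec.independent (e ` {..d})" and inj: "inj_on e {..d}"
    by (simp_all add: lessThan_Suc_atMost)
  have "x \<in> vec.span (e ` {..d})"
  proof (rule ccontr)
    assume *: "x \<notin> vec.span (e ` {..d})"
    then have "x \<notin> e ` {..d}" by (metis vec.span_base)
    then have "card (insert x (e ` {..d})) = d + 2" by (simp add: card_image[OF inj])
    moreover have "insert x (e ` {..d}) \<subseteq> vec.span (unit_vector ` {..d})"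
      using x supp supported_in_span_units by blast
    ultimately show False
      using vec.independent_span_bound[OF _ vec.independent_insertI[OF * ind], of "unit_vector ` {..d}"]
      by (simp add: card_image[OF unit_vector_inj])
  qed
  then obtain u where "x = (\<Sum>v\<in>e ` {..d}. vec_scale (u v) v)"
    by (auto simp: vec.span_finite)
  then have "x = (\<lambda>i. \<Sum>s\<le>d. u (e s) * e s i)"
    by (auto simp: sum.reindex[OF inj] sum_fun_apply vec_scale_def)
  then show ?thesis by (intro exI[of _ "\<lambda>s. u (e s)"])
qed

text \<open>
  Given a point where the earlier forms do not vanish, moving it along a line towards a point
  where the next form does not vanish excludes only finitely many parameters.
\<close>

lemma forms_common_nonzero:
  fixes F :: "'i \<Rightarrow> 'k::field_char_0 mpoly"
  assumes "finite A" "\<And>i. i \<in> A \<Longrightarrow> \<exists>n. F i \<in> forms d n" "\<And>i. i \<in> A \<Longrightarrow> F i \<noteq> 0"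
  shows "\<exists>x. supported d x \<and> (\<forall>i\<in>A. mpoly_eval (F i) x \<noteq> 0)"
  using assms
proof (induction A rule: finite_induct)
  case empty
  then show ?case by (auto intro: exI[of _ "\<lambda>_. 0"] simp: supported_def)
next
  case (insert a A)
  have "\<exists>x. supported d x \<and> (\<forall>i\<in>A. mpoly_eval (F i) x \<noteq> 0)"
    by (rule insert.IH) (use insert.prems in auto)
  then obtain x where x: "supported d x" "\<forall>i\<in>A. mpoly_eval (F i) x \<noteq> 0"
    by auto
  obtain n where "F a \<in> forms d n" "F a \<noteq> 0" using insert.prems by auto
  then obtain y where y: "supported d y" "mpoly_eval (F a) y \<noteq> 0"
    using form_eq_0I by metis
  define P where "P i = line (F i) x (\<lambda>j. y j - x j)" for i
  have P: "poly (P i) 0 = mpoly_eval (F i) x" "poly (P i) 1 = mpoly_eval (F i) y" for i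
    by (simp_all add: P_def poly_line)
  have "P i \<noteq> 0" if "i \<in> insert a A" for i
    using that P x y by (metis insert_iff poly_0)
  then have "finite (\<Union>i\<in>insert a A. {t. poly (P i) t = 0})"
    using insert.hyps poly_roots_finite by auto
  then obtain t where "t \<notin> (\<Union>i\<in>insert a A. {t. poly (P i) t = 0})"
    using infinite_UNIV_char_0 ex_new_if_finite by blast
  then show ?case using x y
    by (intro exI[of _ "\<lambda>j. x j + t * (y j - x j)"]) (auto simp: P_def poly_line supported_def)
qed

text \<open>
  Start at a point where none of the forms vanishes and move in a direction outside the span of
  \<open>B\<close>: finitely many parameters are excluded by the forms, and at most one by the span.
\<close>

lemma generic_vector:
  fixes F :: "'i \<Rightarrow> 'k::field_char_0 mpoly"
  assumes A: "finite A" "\<And>i. i \<in> A \<Longrightarrow> \<exists>n. F i \<in> forms d n" "\<And>i. i \<in> A \<Longrightarrow> F i \<noteq> 0"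
    and B: "finite B" "card B \<le> d"
  shows "\<exists>r. supported d r \<and> r \<notin> vec.span B \<and> (\<forall>i\<in>A. mpoly_eval (F i) r \<noteq> 0)"
proof -
  obtain x where x: "supported d x" "\<forall>i\<in>A. mpoly_eval (F i) x \<noteq> 0"
    using forms_common_nonzero[where A = A and F = F and d = d] A by blast
  obtain j where j: "j \<le> d" "(unit_vector j :: nat \<Rightarrow> 'k) \<notin> vec.span B"
    using unit_vector_outside_span[OF B] by auto
  define y where "y t = x + vec_scale t (unit_vector j)" for t
  have y_eq: "y t = (\<lambda>i. x i + t * unit_vector j i)" for t
    by (auto simp: y_def vec_scale_def)
  have "finite {t. y t \<in> vec.span B}"
  proof (cases "\<exists>t. y t \<in> vec.span B")
    case True
    then obtain t where t: "y t \<in> vec.span B" by auto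
    have "t' = t" if "y t' \<in> vec.span B" for t'
    proof (rule ccontr)
      assume "t' \<noteq> t"
      have "y t' - y t = vec_scale (t' - t) (unit_vector j)"
        by (auto simp: y_def vec_scale_def algebra_simps)
      then have "vec_scale (t' - t) (unit_vector j) \<in> vec.span B"
        using vec.span_diff[OF that t] by simp
      then have "vec_scale (inverse (t' - t)) (vec_scale (t' - t) (unit_vector j)) \<in> vec.span B"
        by (rule vec.span_scale)
      then show False using j \<open>t' \<noteq> t\<close> by simp
    qed
    then have "{t. y t \<in> vec.span B} \<subseteq> {t}" by auto
    then show ?thesis using finite_subset by blast
  qed simp
  moreover have "finite {t. poly (line (F i) x (unit_vector j)) t = 0}" if "i \<in> A" for i
  proof (rule poly_roots_finite)
    have "poly (line (F i) x (unit_vector j)) 0 \<noteq> 0" using x that by (simp add: poly_line)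
    then show "line (F i) x (unit_vector j) \<noteq> 0" by auto
  qed
  ultimately have "finite ({t. y t \<in> vec.span B} \<union> (\<Union>i\<in>A. {t. poly (line (F i) x (unit_vector j)) t = 0}))"
    using A(1) by auto
  then obtain t where
    "t \<notin> {t. y t \<in> vec.span B} \<union> (\<Union>i\<in>A. {t. poly (line (F i) x (unit_vector j)) t = 0})"
    using infinite_UNIV_char_0 ex_new_if_finite by blast
  moreover have "supported d (y t)"
    using x(1) j by (auto simp: y_eq supported_def unit_vector_def)
  ultimately show ?thesis by (intro exI[of _ "y t"]) (auto simp: poly_line y_eq)
qed

text \<open>
  The points are chosen one after the other.  At stage \<open>s\<close> the iterated joins with the earlier
  points are already determined; each of them that is not dense lies in the zero set of some
  nonzero form, and the next point is taken off these zero sets and off the span of the earlier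
  points.
\<close>

lemma points_in_general_position:
  fixes C :: "'i \<Rightarrow> (nat \<Rightarrow> 'k::field_char_0) set" and m :: "'i \<Rightarrow> nat"
  assumes I: "finite I"
  shows "\<exists>e. (\<forall>s\<le>d. supported d (e s)) \<and> (\<forall>s\<le>d. e s \<notin> vec.span (e ` {..<s})) \<and>
    (\<forall>s\<le>d. \<forall>i\<in>I. \<forall>F n. F \<in> forms d n \<and> F \<noteq> 0 \<and> (\<forall>v\<in>iterated_join (m i) e (C i) s. mpoly_eval F v = 0) \<longrightarrow>
       (\<exists>F n. F \<in> forms d n \<and> (\<forall>v\<in>iterated_join (m i) e (C i) s. mpoly_eval F v = 0) \<and> mpoly_eval F (e s) \<noteq> 0))"
proof -
  define Q where "Q e s i F \<longleftrightarrow> (\<exists>n. F \<in> forms d n) \<and> (\<forall>v\<in>iterated_join (m i) e (C i) s. mpoly_eval F v = 0)"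
    for e s i F
  define P where "P e s r \<longleftrightarrow> (s \<le> d \<longrightarrow> supported d r \<and> r \<notin> vec.span (e ` {..<s}) \<and>
     (\<forall>i\<in>I. (\<exists>F. F \<noteq> 0 \<and> Q e s i F) \<longrightarrow> (\<exists>F. Q e s i F \<and> mpoly_eval F r \<noteq> 0)))" for e s r
  have "\<exists>e. \<forall>s. P e s (e s)"
  proof (rule dependent_wellorder_choice)
    fix r s and f g :: "nat \<Rightarrow> nat \<Rightarrow> 'k" assume "\<And>y. y < s \<Longrightarrow> f y = g y"
    then have "f ` {..<s} = g ` {..<s}" "Q f s = Q g s"
      using iterated_join_cong[of s f g] unfolding Q_def by auto
    then show "P f s r = P g s r" by (simp add: P_def)
  next
    fix s and e :: "nat \<Rightarrow> nat \<Rightarrow> 'k"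
    show "\<exists>r. P e s r"
    proof (cases "s \<le> d")
      case True
      define A where "A = {i\<in>I. \<exists>F. F \<noteq> 0 \<and> Q e s i F}"
      have "\<exists>F. \<forall>i\<in>A. F i \<noteq> 0 \<and> Q e s i (F i)" unfolding A_def by (rule bchoice) auto
      then obtain F where F: "\<And>i. i \<in> A \<Longrightarrow> F i \<noteq> 0 \<and> Q e s i (F i)" by auto
      have "card (e ` {..<s}) \<le> d" using True card_image_le[of "{..<s}" e] by simp
      then have "\<exists>r. supported d r \<and> r \<notin> vec.span (e ` {..<s}) \<and> (\<forall>i\<in>A. mpoly_eval (F i) r \<noteq> 0)"
        using F I by (intro generic_vector) (auto simp: A_def Q_def)
      then show ?thesis using F unfolding P_def A_def by blast
    qed (auto simp: P_def)
  qed
  then obtain e where e: "\<And>s. P e s (e s)" by auto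
  then show ?thesis
    unfolding P_def Q_def by (intro exI[of _ e]) meson
qed

section \<open>Hasse derivatives\<close>

text \<open>The Taylor expansion \<open>F(X + t u)\<close>, as a polynomial in \<open>t\<close> with coefficients in \<open>k[X]\<close>.\<close>

definition shift :: "(nat \<Rightarrow> 'k::comm_ring_1) \<Rightarrow> 'k mpoly \<Rightarrow> 'k mpoly poly" where
  "shift u F = mpoly_subst (\<lambda>c. [:mpoly_const c:]) (\<lambda>i. [:mpoly_var i, mpoly_const (u i):]) F"

definition hasse :: "(nat \<Rightarrow> 'k::comm_ring_1) \<Rightarrow> nat \<Rightarrow> 'k mpoly \<Rightarrow> 'k mpoly" where
  "hasse u a F = coeff (shift u F) a"

lemma ring_homomorphism_shift: "ring_homomorphism (shift u)"
  unfolding shift_def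
  by (intro ring_homomorphism_mpoly_subst ring_homomorphism_comp[OF ring_homomorphism_poly_const]
      ring_homomorphism_mpoly_const)

lemma hasse_add: "hasse u a (F + G) = hasse u a F + hasse u a G"
  by (simp add: hasse_def ring_homomorphismD[OF ring_homomorphism_shift])

lemma hasse_scale: "hasse u a (mpoly_scale c F) = mpoly_scale c (hasse u a F)"
proof -
  have "shift u (mpoly_const c) = [:mpoly_const c:]"
    unfolding shift_def
    by (intro mpoly_subst_const ring_homomorphism_comp[OF ring_homomorphism_poly_const]
        ring_homomorphism_mpoly_const)
  then show ?thesis
    by (simp add: hasse_def mpoly_scale_def ring_homomorphismD[OF ring_homomorphism_shift])
qed

lemma map_shift:
  assumes g: "ring_homomorphism g"
  shows "map_poly g (shift u F) =
    mpoly_subst (\<lambda>c. [:g (mpoly_const c):]) (\<lambda>i. [:g (mpoly_var i), g (mpoly_const (u i)):]) F"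
  unfolding shift_def hom_mpoly_subst[OF ring_homomorphism_map_poly[OF g]]
  by (simp add: map_poly_pCons ring_homomorphismD[OF g])

lemma coeff_map_shift:
  "ring_homomorphism g \<Longrightarrow> coeff (map_poly g (shift u F)) a = g (hasse u a F)"
  by (simp add: hasse_def coeff_map_poly ring_homomorphismD)

lemma eval_hasse: "mpoly_eval (hasse u a F) x = coeff (line F x u) a"
  using coeff_map_shift[OF ring_homomorphism_eval, of x u F a]
  by (simp add: map_shift[OF ring_homomorphism_eval] line_def)

lemma hasse_forms:
  assumes "F \<in> forms d n"
  shows "hasse u a F \<in> forms d (n - a)" "n < a \<Longrightarrow> hasse u a F = 0"
proof -
  define G where "G n = {P :: 'a mpoly poly. \<forall>a. coeff P a \<in> forms d (n - a) \<and> (n < a \<longrightarrow> coeff P a = 0)}" for n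
  have "multiplicative_grading G"
    unfolding multiplicative_grading_def
  proof (intro conjI allI ballI)
    show "1 \<in> G 0"
      by (auto simp: G_def coeff_pCons one_pCons one_in_forms split: nat.splits)
    fix m n P Q assume P: "P \<in> G m" and Q: "Q \<in> G n"
    have "coeff P i * coeff Q (a - i) \<in> forms d (m + n - a) \<and> (m + n < a \<longrightarrow> coeff P i * coeff Q (a - i) = 0)"
      if "i \<le> a" for a i
    proof (cases "i \<le> m \<and> a - i \<le> n")
      case True
      have "coeff P i * coeff Q (a - i) \<in> forms d ((m - i) + (n - (a - i)))"
        using P Q by (intro forms_mult) (auto simp: G_def)
      moreover have "(m - i) + (n - (a - i)) = m + n - a" using that True by auto
      ultimately show ?thesis using True that by auto
    next
      case False
      then have "coeff P i = 0 \<or> coeff Q (a - i) = 0" using P Q by (auto simp: G_def)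
      then show ?thesis by auto
    qed
    then show "P * Q \<in> G (m + n)"
      by (auto simp: G_def coeff_mult intro!: forms_sum sum.neutral)
  qed (auto simp: G_def forms_add)
  then have "shift u F \<in> G n"
    unfolding shift_def
  proof (rule grading_subst[OF _ assms])
    show "[:mpoly_const c:] \<in> G 0" for c
      by (auto simp: G_def coeff_pCons forms_const split: nat.splits)
    show "[:mpoly_var i, mpoly_const (u i):] \<in> G 1" if "i \<le> d" for i
      using forms_var[OF that] forms_const by (auto simp: G_def coeff_pCons split: nat.splits)
  qed
  then show "hasse u a F \<in> forms d (n - a)" "n < a \<Longrightarrow> hasse u a F = 0"
    by (auto simp: G_def hasse_def)
qed

definition translation_invariant :: "(nat \<Rightarrow> 'k::comm_ring_1) \<Rightarrow> 'k mpoly \<Rightarrow> bool" where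
  "translation_invariant u F \<longleftrightarrow> (\<forall>x c. mpoly_eval F (\<lambda>i. x i + c * u i) = mpoly_eval F x)"

lemma hasse_translation_invariant:
  fixes F :: "'k::field_char_0 mpoly"
  assumes "translation_invariant w F"
  shows "translation_invariant w (hasse u a F)"
  unfolding translation_invariant_def
proof (intro allI)
  fix x c
  have "poly (line F (\<lambda>i. x i + c * w i) u) t = poly (line F x u) t" for t
  proof -
    have "(\<lambda>i. x i + c * w i + t * u i) = (\<lambda>i. (x i + t * u i) + c * w i)" by (auto simp: algebra_simps)
    then show ?thesis using assms by (simp add: poly_line translation_invariant_def)
  qed
  then have "line F (\<lambda>i. x i + c * w i) u = line F x u"
    by (simp flip: poly_eq_poly_eq_iff add: fun_eq_iff)
  then show "mpoly_eval (hasse u a F) (\<lambda>i. x i + c * w i) = mpoly_eval (hasse u a F) x"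
    by (simp add: eval_hasse)
qed

text \<open>Translating \<open>x\<close> along \<open>u\<close> reparametrises the line, which preserves the top coefficient.\<close>

lemma top_hasse_translation_invariant:
  fixes F :: "'k::field_char_0 mpoly"
  assumes top: "degree (shift u F) \<le> a"
  shows "translation_invariant u (hasse u a F)"
  unfolding translation_invariant_def
proof (intro allI)
  fix x c
  define p where "p = line F x u"
  have "poly (line F (\<lambda>i. x i + c * u i) u) t = poly (p \<circ>\<^sub>p [:c, 1:]) t" for t
    by (simp add: p_def poly_line poly_pcompose algebra_simps)
  then have eq: "line F (\<lambda>i. x i + c * u i) u = p \<circ>\<^sub>p [:c, 1:]"
    by (simp flip: poly_eq_poly_eq_iff add: fun_eq_iff)
  have "coeff p b = 0" if "b > a" for b
    using eval_hasse[of u b F x] that top by (simp add: p_def hasse_def coeff_eq_0)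
  then have "degree p \<le> a" using degree_le by blast
  have "coeff (p \<circ>\<^sub>p [:c, 1:]) a = coeff p a"
  proof (cases "degree p = a")
    case True
    then show ?thesis using lead_coeff_comp[of "[:c, 1:]" p] by (simp add: degree_pcompose)
  next
    case False
    then show ?thesis using \<open>degree p \<le> a\<close> by (simp add: coeff_eq_0 degree_pcompose)
  qed
  then show "mpoly_eval (hasse u a F) (\<lambda>i. x i + c * u i) = mpoly_eval (hasse u a F) x"
    by (simp add: eval_hasse eq p_def)
qed


section \<open>Order of vanishing along lines\<close>

text \<open>
  A description of the order of vanishing at \<open>v\<close> on the affine cone that refers to no chart and
  to no coordinates, so that it can be tested in the directions \<open>e 0, e 1, \<dots>\<close>.
\<close>

definition order_on_lines :: "(nat \<Rightarrow> 'k::comm_ring_1) \<Rightarrow> nat \<Rightarrow> 'k mpoly \<Rightarrow> bool" where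
  "order_on_lines v p F \<longleftrightarrow> (\<forall>u. \<forall>a<p. coeff (line F v u) a = 0)"

lemma order_on_lines_eval: "order_on_lines v p F \<Longrightarrow> p > 0 \<Longrightarrow> mpoly_eval F v = 0"
  using poly_line[of F v v 0] by (simp add: order_on_lines_def poly_0_coeff_0)

text \<open>
  Restrict the polynomial \<open>F(v + t w + s u)\<close> in \<open>t, s\<close> to all lines \<open>s = c t\<close>: each
  restriction is divisible by \<open>t\<^sup>p\<close>, and its coefficients are polynomials in \<open>c\<close> that list the
  homogeneous components in \<open>(t, s)\<close>.
\<close>

lemma hasse_order_on_lines:
  fixes F :: "'k::field_char_0 mpoly"
  assumes ord: "order_on_lines v p F"
  shows "order_on_lines v (p - b) (hasse u b F)"
  unfolding order_on_lines_def
proof (intro allI impI)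
  fix w a assume a: "a < p - b"
  define K where "K = map_poly (\<lambda>G. line G v w) (shift u F)"
  have hom: "ring_homomorphism (\<lambda>G. line G v w)"
    unfolding line_def by (rule ring_homomorphism_mpoly_subst[OF ring_homomorphism_poly_const])
  have coeff_K: "coeff K j = line (hasse u j F) v w" for j
    unfolding K_def by (rule coeff_map_shift[OF hom])
  have "line (mpoly_const c) v w = [:c:]" "line (mpoly_var i) v w = [:v i, w i:]" for c i
    unfolding line_def
    by (simp_all add: mpoly_subst_const[OF ring_homomorphism_poly_const] mpoly_subst_var[OF ring_homomorphism_poly_const])
  then have K: "K = mpoly_subst (\<lambda>c. [:[:c:]:]) (\<lambda>i. [:[:v i, w i:], [:u i:]:]) F"
    unfolding K_def map_shift[OF hom] by simp
  have poly_K: "poly K [:0, c:] = line F v (\<lambda>i. w i + c * u i)" for c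
    unfolding K line_def by (simp add: hom_mpoly_subst[OF ring_homomorphism_poly] mult.commute)
  define n where "n = a + b"
  define R where "R = (\<Sum>j\<le>degree K. monom (if n < j then 0 else coeff (coeff K j) (n - j)) j)"
  have "poly R c = 0" for c
  proof -
    have "[:0, c:] ^ j = monom (c ^ j) j" for j
      using monom_power[of c 1 j] by (simp add: monom_altdef)
    then have "coeff (poly K [:0, c:]) n = (\<Sum>j\<le>degree K. coeff (monom (c ^ j) j * coeff K j) n)"
      by (simp add: poly_altdef coeff_sum mult.commute)
    also have "\<dots> = poly R c"
      unfolding R_def poly_sum by (intro sum.cong) (auto simp: coeff_monom_mult poly_monom)
    finally show ?thesis
      using ord a by (simp add: poly_K order_on_lines_def n_def)
  qed
  then have "R = 0" by (metis poly_all_0_iff_0)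
  then have "coeff R b = 0" by simp
  moreover have "coeff R b = (if b \<le> degree K then coeff (coeff K b) a else 0)"
    by (simp add: R_def coeff_sum n_def sum.delta cong: if_cong)
  ultimately have "coeff (coeff K b) a = 0"
    by (cases "b \<le> degree K") (auto simp: coeff_eq_0)
  then show "coeff (line (hasse u b F) v w) a = 0"
    by (simp add: coeff_K)
qed


section \<open>Iterated leading coefficients\<close>

fun hasse_seq :: "(nat \<Rightarrow> nat \<Rightarrow> 'k::comm_ring_1) \<Rightarrow> (nat \<Rightarrow> nat) \<Rightarrow> 'k mpoly \<Rightarrow> nat \<Rightarrow> 'k mpoly" where
  "hasse_seq e \<alpha> F 0 = F"
| "hasse_seq e \<alpha> F (Suc s) = hasse (e s) (\<alpha> s) (hasse_seq e \<alpha> F s)"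

lemma hasse_seq_cong: "(\<And>l. l < s \<Longrightarrow> \<alpha> l = \<beta> l) \<Longrightarrow> hasse_seq e \<alpha> F s = hasse_seq e \<beta> F s"
  by (induction s) auto

lemma hasse_seq_add: "hasse_seq e \<alpha> (F + G) s = hasse_seq e \<alpha> F s + hasse_seq e \<alpha> G s"
  by (induction s) (auto simp: hasse_add)

lemma hasse_seq_scale: "hasse_seq e \<alpha> (mpoly_scale c F) s = mpoly_scale c (hasse_seq e \<alpha> F s)"
  by (induction s) (auto simp: hasse_scale)

lemma hasse_seq_order_on_lines:
  fixes F :: "'k::field_char_0 mpoly"
  assumes "order_on_lines v p F"
  shows "order_on_lines v (p - (\<Sum>l<s. \<alpha> l)) (hasse_seq e \<alpha> F s)"
proof (induction s)
  case (Suc s)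
  then show ?case using hasse_order_on_lines by fastforce
qed (simp add: assms)

lemma shift_nonzero:
  fixes F :: "'k::field_char_0 mpoly"
  assumes "F \<in> forms d n" "F \<noteq> 0"
  shows "shift u F \<noteq> 0"
proof
  assume *: "shift u F = 0"
  have "F = 0"
  proof (rule form_eq_0I[OF assms(1)])
    fix v
    have "mpoly_eval F v = poly (line F v u) 0" by (simp add: poly_line)
    also have "\<dots> = mpoly_eval (hasse u 0 F) v" by (simp add: eval_hasse poly_0_coeff_0)
    also have "\<dots> = 0" using * by (simp add: hasse_def)
    finally show "mpoly_eval F v = 0" .
  qed
  then show False using assms by simp
qed

text \<open>
  Each step takes the top Taylor coefficient in the direction \<open>e s\<close>, which makes the result
  invariant in that direction; the invariance acquired in earlier steps persists.
\<close>

lemma leading_exponent: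
  fixes F :: "'k::field_char_0 mpoly"
  assumes F: "F \<in> forms d q" "F \<noteq> 0"
  shows "\<exists>\<alpha>. \<forall>s. hasse_seq e \<alpha> F s \<in> forms d (q - (\<Sum>l<s. \<alpha> l)) \<and> (\<Sum>l<s. \<alpha> l) \<le> q \<and>
           hasse_seq e \<alpha> F s \<noteq> 0 \<and> (\<forall>l<s. translation_invariant (e l) (hasse_seq e \<alpha> F s))"
proof -
  define G where "G = rec_nat F (\<lambda>s G. hasse (e s) (degree (shift (e s) G)) G)"
  define \<alpha> where "\<alpha> s = degree (shift (e s) (G s))" for s
  have G: "hasse_seq e \<alpha> F s = G s" for s
    by (induction s) (simp_all add: G_def \<alpha>_def)
  have "G s \<in> forms d (q - (\<Sum>l<s. \<alpha> l)) \<and> (\<Sum>l<s. \<alpha> l) \<le> q \<and> G s \<noteq> 0 \<and>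
          (\<forall>l<s. translation_invariant (e l) (G s))" for s
  proof (induction s)
    case 0
    then show ?case using F by (simp add: G_def)
  next
    case (Suc s)
    have G_Suc: "G (Suc s) = hasse (e s) (\<alpha> s) (G s)" by (simp add: G_def \<alpha>_def)
    have "G (Suc s) = lead_coeff (shift (e s) (G s))" by (simp add: G_Suc hasse_def \<alpha>_def)
    then have nz: "G (Suc s) \<noteq> 0" using shift_nonzero[of "G s"] Suc by auto
    have "\<alpha> s \<le> q - (\<Sum>l<s. \<alpha> l)"
      using hasse_forms(2) Suc nz unfolding G_Suc by (metis not_le)
    moreover have "G (Suc s) \<in> forms d (q - (\<Sum>l<s. \<alpha> l) - \<alpha> s)"
      unfolding G_Suc using hasse_forms(1) Suc by blast
    moreover have "translation_invariant (e l) (G (Suc s))" if "l < Suc s" for l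
    proof (cases "l = s")
      case True
      then show ?thesis unfolding G_Suc by (simp add: top_hasse_translation_invariant \<alpha>_def)
    next
      case False
      then show ?thesis using that Suc unfolding G_Suc by (intro hasse_translation_invariant) auto
    qed
    ultimately show ?case using Suc nz by auto
  qed
  then show ?thesis using G by (intro exI[of _ \<alpha>]) simp
qed

lemma vanishes_on_iterated_join:
  assumes "\<And>l. l < s \<Longrightarrow> translation_invariant (e l) F" "\<forall>v\<in>C. mpoly_eval F v = 0"
  shows "\<forall>v\<in>iterated_join m e C s. mpoly_eval F v = 0"
  using assms
proof (induction s)
  case (Suc s)
  have "mpoly_eval F (\<lambda>i. y i + c * y m * e s i) = mpoly_eval F y" for y c
    using Suc.prems(1)[of s] by (simp add: translation_invariant_def)
  then show ?case using Suc by (auto simp: join_step_def)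
qed simp

lemma eval_translation_invariant_sum:
  fixes e :: "nat \<Rightarrow> nat \<Rightarrow> 'k::comm_ring_1"
  assumes "\<And>l. l < s \<Longrightarrow> translation_invariant (e l) F"
  shows "mpoly_eval F (\<lambda>i. (\<Sum>l<s. c l * e l i) + x i) = mpoly_eval F x"
  using assms
proof (induction s)
  case (Suc s)
  have "mpoly_eval F (\<lambda>i. ((\<Sum>l<s. c l * e l i) + x i) + c s * e s i) = mpoly_eval F (\<lambda>i. (\<Sum>l<s. c l * e l i) + x i)"
    using Suc.prems[of s] by (simp add: translation_invariant_def)
  then show ?case using Suc by (simp add: add_ac)
qed simp

text \<open>
  A form that is invariant under \<open>e 0, \<dots>, e (d - 1)\<close> is a multiple of a power of the linear
  form that these vectors kill, so it is determined by its value at \<open>e d\<close>.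
\<close>

lemma invariant_form_nonzero_at_last:
  fixes F :: "'k::field_char_0 mpoly"
  assumes F: "F \<in> forms d n" "F \<noteq> 0"
    and inv: "\<And>l. l < d \<Longrightarrow> translation_invariant (e l) F"
    and span: "\<And>x. supported d x \<Longrightarrow> \<exists>c. x = (\<lambda>i. \<Sum>s\<le>d. c s * e s i)"
  shows "mpoly_eval F (e d) \<noteq> 0"
proof
  assume zero: "mpoly_eval F (e d) = 0"
  have "F = 0"
  proof (rule form_eq_0I[OF F(1)])
    fix x :: "nat \<Rightarrow> 'k" assume "supported d x"
    then obtain c where "x = (\<lambda>i. \<Sum>s\<le>d. c s * e s i)" using span by blast
    then have "x = (\<lambda>i. (\<Sum>l<d. c l * e l i) + c d * e d i)"
      by (simp add: lessThan_Suc_atMost[symmetric])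
    then have "mpoly_eval F x = mpoly_eval F (\<lambda>i. c d * e d i)"
      using eval_translation_invariant_sum[OF inv] by simp
    then show "mpoly_eval F x = 0" using zero by (simp add: eval_homogeneous[OF F(1)])
  qed
  then show False using F by simp
qed

section \<open>From a chart to lines through the point\<close>

text \<open>
  Normalise \<open>v\<close> to \<open>w = v / v j\<close> and write \<open>H\<close> for the expansion of \<open>F\<close> in the chart.  Along the
  line \<open>w + t u\<close> the \<open>j\<close>-th coordinate is \<open>U = 1 + t u\<^sub>j\<close>, and homogeneity gives
  \<open>F (w + t u) = U\<^sup>q H (B / U)\<close> with \<open>B = t (u - u\<^sub>j w)\<close>.  Clearing denominators, every term
  of \<open>H\<close> contributes a multiple of \<open>t\<^sup>p\<close>, while \<open>U\<close> is not divisible by \<open>t\<close>.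
\<close>

lemma order_on_lines_if_chart_order:
  fixes F :: "'k::field_char_0 mpoly"
  assumes F: "F \<in> forms d q" and vj: "v j \<noteq> 0"
    and ord: "\<forall>m\<in>Poly_Mapping.keys (chart_expansion j v F). p \<le> total_degree m"
  shows "order_on_lines (\<lambda>i. v i / v j) p F"
  unfolding order_on_lines_def
proof
  fix u :: "nat \<Rightarrow> 'k"
  define w where "w = (\<lambda>i. v i / v j)"
  define H where "H = chart_expansion j v F"
  let ?K = "Poly_Mapping.keys H"
  define N where "N = (\<Sum>m\<in>?K. total_degree m)"
  have N: "total_degree m \<le> N" if "m \<in> ?K" for m
    unfolding N_def using that by (intro member_le_sum) auto
  \<comment> \<open>\<open>N\<close> bounds the degrees in \<open>H\<close>, so multiplication by \<open>U\<^sup>N\<close> clears all denominators.\<close>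
  define U where "U = [:1, u j:]"
  define b where "b i = u i - u j * w i" for i
  define R where "R = (\<Sum>m\<in>?K. [:Poly_Mapping.lookup H m:] *
     ([:0, 1:] ^ total_degree m * [:monomial_value b m:]) * U ^ (q + N - total_degree m))"
  have "U ^ N * line F w u - R = 0"
  proof (rule poly_eq_0_if_zero_off_finite[where A = "{t. 1 + t * u j = 0}"])
    show "finite {t. 1 + t * u j = 0}"
      using poly_roots_finite[of U] by (simp add: U_def)
    fix t assume "t \<notin> {t. 1 + t * u j = 0}"
    then obtain c where c: "c = 1 + t * u j" "c \<noteq> 0" by simp
    define y where "y = (\<lambda>i. t / c * b i)"
    have "w j = 1" using vj by (simp add: w_def)
    then have "y j = 0" by (simp add: y_def b_def)
    have "(\<lambda>i. w i + t * u i) = (\<lambda>i. c * (y i + w i))"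
      using c(2) by (intro ext) (simp add: y_def b_def distrib_left, simp add: c(1) algebra_simps)
    then have "mpoly_eval F (\<lambda>i. w i + t * u i) = c ^ q * mpoly_eval F (\<lambda>i. y i + w i)"
      by (simp add: eval_homogeneous[OF F])
    also have "(\<lambda>i. y i + w i) =
        (\<lambda>i. mpoly_eval (if i = j then 1 else mpoly_var i + mpoly_const (v i / v j)) y)"
      using \<open>w j = 1\<close> \<open>y j = 0\<close> by (auto simp: w_def)
    also have "mpoly_eval F \<dots> = mpoly_eval H y"
      by (simp add: H_def chart_expansion_def mpoly_eval_subst)
    also have "mpoly_eval H y = (\<Sum>m\<in>?K. Poly_Mapping.lookup H m * ((t / c) ^ total_degree m * monomial_value b m))"
      by (simp only: mpoly_eval_def mpoly_subst_altdef y_def monomial_value_scale)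
    finally have "c ^ N * mpoly_eval F (\<lambda>i. w i + t * u i) =
        (\<Sum>m\<in>?K. c ^ (q + N) * (Poly_Mapping.lookup H m * ((t / c) ^ total_degree m * monomial_value b m)))"
      by (simp add: sum_distrib_left power_add mult_ac)
    also have "\<dots> = poly R t"
      unfolding R_def poly_sum
    proof (intro sum.cong refl)
      fix m assume "m \<in> ?K"
      then have "c ^ (q + N) = c ^ (q + N - total_degree m) * c ^ total_degree m"
        using N[of m] by (simp flip: power_add)
      then show "c ^ (q + N) * (Poly_Mapping.lookup H m * ((t / c) ^ total_degree m * monomial_value b m)) =
         poly ([:Poly_Mapping.lookup H m:] * ([:0, 1:] ^ total_degree m * [:monomial_value b m:]) *
            U ^ (q + N - total_degree m)) t"
        using c(2) by (simp add: U_def c(1)[symmetric] power_divide)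
    qed
    finally show "poly (U ^ N * line F w u - R) t = 0"
      by (simp add: U_def c(1) poly_line)
  qed
  then have R: "U ^ N * line F w u = R" by simp
  have "[:0, 1:] ^ p dvd R"
    unfolding R_def
  proof (rule dvd_sum)
    fix m assume "m \<in> ?K"
    then have "p \<le> total_degree m" using ord by (simp add: H_def)
    then have "[:0, 1:] ^ p dvd ([:0, 1:] ^ total_degree m :: 'k poly)" by (rule le_imp_power_dvd)
    then show "[:0, 1:] ^ p dvd [:Poly_Mapping.lookup H m:] *
        ([:0, 1:] ^ total_degree m * [:monomial_value b m:]) * U ^ (q + N - total_degree m)"
      by (rule dvd_mult2[OF dvd_mult[OF dvd_mult2]])
  qed
  then have dvd: "monom 1 p dvd U ^ N * line F w u" by (simp add: R monom_altdef)
  show "\<forall>a<p. coeff (line F w u) a = 0"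
  proof (cases "line F w u = 0")
    case False
    have "U \<noteq> 0" by (simp add: U_def)
    then have nz: "U ^ N * line F w u \<noteq> 0" using False by simp
    have "order 0 (U ^ N) = 0" by (rule order_0I) (simp add: U_def)
    then have "p \<le> order 0 (line F w u)"
      using dvd order_mult[OF nz, of 0] by (simp add: monom_1_dvd_iff[OF nz])
    then show ?thesis using monom_1_dvd_iff[OF False] monom_1_dvd_iff' by blast
  qed simp
qed


section \<open>Dimensions of spaces of forms\<close>

lemma lookup_mpoly_scale [simp]:
  "Poly_Mapping.lookup (mpoly_scale c F) m = c * Poly_Mapping.lookup F m"
  by (simp add: mpoly_scale_def mpoly_const_def flip: mult_map_scale_conv_mult)
     (simp add: Poly_Mapping.map.rep_eq when_def)

lemma mpoly_eval_scale: "mpoly_eval (mpoly_scale c F) v = c * mpoly_eval F v"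
  by (simp add: mpoly_scale_def)

lemma lookup_single_combination:
  "finite A \<Longrightarrow> Poly_Mapping.lookup (\<Sum>a\<in>A. Poly_Mapping.single a (g a)) b = (if b \<in> A then g b else 0)"
  by (simp add: lookup_sum lookup_single when_def)

lemma single_combination_in_span:
  "(\<Sum>a\<in>A. Poly_Mapping.single a (g a)) \<in> mpoly.span ((\<lambda>a. Poly_Mapping.single a (1::'k::field)) ` A)"
proof (rule mpoly.span_sum)
  fix a assume "a \<in> A"
  have "Poly_Mapping.single a (g a) = mpoly_scale (g a) (Poly_Mapping.single a 1)"
    by (rule poly_mapping_eqI) (simp add: lookup_single when_def)
  then show "Poly_Mapping.single a (g a) \<in> mpoly.span ((\<lambda>a. Poly_Mapping.single a 1) ` A)"
    using \<open>a \<in> A\<close> by (simp add: mpoly.span_scale mpoly.span_base)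
qed

lemma vector_space_pair_mpoly:
  "vector_space_pair (mpoly_scale :: 'k::field \<Rightarrow> _) (mpoly_scale :: 'k \<Rightarrow> _)"
  unfolding vector_space_pair_def using mpoly.vector_space_axioms by simp

text \<open>
  The functionals are the coefficients of an injective linear map from \<open>V\<close> into the span of the
  monomials in \<open>A\<close>.
\<close>

lemma dim_le_card_separating_functionals:
  fixes f :: "monomial \<Rightarrow> 'k::field mpoly \<Rightarrow> 'k"
  assumes V: "mpoly.subspace V" and A: "finite A"
    and add: "\<And>a F G. f a (F + G) = f a F + f a G"
    and scale: "\<And>a c F. f a (mpoly_scale c F) = c * f a F"
    and sep: "\<And>F. F \<in> V \<Longrightarrow> F \<noteq> 0 \<Longrightarrow> \<exists>a\<in>A. f a F \<noteq> 0"
  shows "mpoly.dim V \<le> card A"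
proof -
  interpret pair: vector_space_pair "mpoly_scale :: 'k \<Rightarrow> _" "mpoly_scale :: 'k \<Rightarrow> _"
    by (rule vector_space_pair_mpoly)
  define \<phi> where "\<phi> F = (\<Sum>a\<in>A. Poly_Mapping.single a (f a F))" for F
  have look: "Poly_Mapping.lookup (\<phi> F) b = (if b \<in> A then f b F else 0)" for F b
    unfolding \<phi>_def by (rule lookup_single_combination[OF A])
  have lin: "Vector_Spaces.linear mpoly_scale mpoly_scale \<phi>"
    unfolding Vector_Spaces.linear_iff using mpoly.vector_space_axioms
    by (auto intro!: poly_mapping_eqI simp: lookup_add look add scale)
  obtain B where B: "B \<subseteq> V" "mpoly.independent B" "card B = mpoly.dim V"
    by (rule mpoly.basis_exists)
  have "mpoly.span B \<subseteq> V" using B V by (intro mpoly.span_minimal)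
  moreover have "F = 0" if F: "F \<in> V" "\<phi> F = 0" for F
  proof (rule ccontr)
    assume "F \<noteq> 0"
    then obtain a where "a \<in> A" "f a F \<noteq> 0" using sep F(1) by blast
    then show False using look[of F a] F(2) by simp
  qed
  ultimately have inj: "inj_on \<phi> (mpoly.span B)"
    by (subst pair.linear_inj_on_iff_eq_0[OF lin]) (auto simp: mpoly.subspace_span)
  have "mpoly.independent (\<phi> ` B)"
    by (rule pair.linear_independent_injective_image[OF lin B(2) inj])
  moreover have "\<phi> ` B \<subseteq> mpoly.span ((\<lambda>a. Poly_Mapping.single a 1) ` A)"
    unfolding \<phi>_def by (rule image_subsetI) (rule single_combination_in_span)
  ultimately have "card (\<phi> ` B) \<le> card ((\<lambda>a. Poly_Mapping.single a (1::'k)) ` A)"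
    using mpoly.independent_span_bound A by blast
  also have "\<dots> \<le> card A" using A by (rule card_image_le)
  also have "card (\<phi> ` B) = card B"
    using inj by (intro card_image) (meson inj_on_subset mpoly.span_superset)
  finally show ?thesis using B by simp
qed

lemma finite_exponents: "finite (exponents d q)"
proof -
  let ?r = "\<lambda>\<alpha>. restrict (Poly_Mapping.lookup \<alpha>) {..d}"
  have "?r ` exponents d q \<subseteq> {..d} \<rightarrow>\<^sub>E {..q}"
  proof -
    have "Poly_Mapping.lookup \<alpha> i \<le> q" if "\<alpha> \<in> exponents d q" "i \<le> d" for \<alpha> i
      using that member_le_sum[of i "{..d}" "Poly_Mapping.lookup \<alpha>"] by (auto simp: exponents_def)
    then show ?thesis by (intro image_subsetI iffD2[OF restrict_PiE_iff]) auto
  qed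
  then have "finite (?r ` exponents d q)" by (rule finite_subset) (auto intro: finite_PiE)
  moreover have "inj_on ?r (exponents d q)"
  proof (intro inj_onI poly_mapping_eqI)
    fix \<alpha> \<beta> i assume ab: "\<alpha> \<in> exponents d q" "\<beta> \<in> exponents d q" "?r \<alpha> = ?r \<beta>"
    show "Poly_Mapping.lookup \<alpha> i = Poly_Mapping.lookup \<beta> i"
    proof (cases "i \<le> d")
      case True
      then show ?thesis using fun_cong[OF ab(3), of i] by simp
    next
      case False
      then have "i \<notin> Poly_Mapping.keys \<alpha>" "i \<notin> Poly_Mapping.keys \<beta>"
        using ab by (auto simp: exponents_def)
      then show ?thesis by (simp add: in_keys_iff)
    qed
  qed
  ultimately show ?thesis by (rule finite_imageD)
qed

lemma forms_in_span_monomials: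
  fixes F :: "'k::field mpoly"
  assumes "F \<in> forms d q"
  shows "F \<in> mpoly.span ((\<lambda>a. Poly_Mapping.single a 1) ` exponents d q)"
proof -
  have "F \<in> mpoly.span ((\<lambda>a. Poly_Mapping.single a 1) ` Poly_Mapping.keys F)"
    using single_combination_in_span[of "Poly_Mapping.lookup F" "Poly_Mapping.keys F"]
    unfolding mpoly_eq_sum_monomials[symmetric] .
  moreover have "Poly_Mapping.keys F \<subseteq> exponents d q" using assms by (simp add: forms_def)
  ultimately show ?thesis by (meson mpoly.span_mono image_mono subsetD)
qed

text \<open>
  A basis of \<open>V\<close> is finite, since finitely many monomials span the forms, and so the exchange
  lemma bounds the size of any independent subset of its span.
\<close>

lemma card_le_dim_forms:
  fixes V :: "'k::field mpoly set"
  assumes V: "V \<subseteq> forms d q" and B: "B \<subseteq> V" "mpoly.independent B"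
  shows "card B \<le> mpoly.dim V"
proof -
  obtain C where C: "C \<subseteq> V" "mpoly.independent C" "V \<subseteq> mpoly.span C" "card C = mpoly.dim V"
    by (rule mpoly.basis_exists)
  have "C \<subseteq> mpoly.span ((\<lambda>a. Poly_Mapping.single a 1) ` exponents d q)"
    using C(1) V forms_in_span_monomials by blast
  then have "finite C"
    using mpoly.independent_span_bound[OF _ C(2)] finite_exponents by blast
  then show ?thesis using mpoly.independent_span_bound[OF _ B(2), of C] B(1) C by auto
qed

lemma chart_expansion_add: "chart_expansion j v (F + G) = chart_expansion j v F + chart_expansion j v G"
  by (simp add: chart_expansion_def mpoly_subst_add ring_homomorphism_mpoly_const)

lemma chart_expansion_mult: "chart_expansion j v (F * G) = chart_expansion j v F * chart_expansion j v G"
  by (simp add: chart_expansion_def mpoly_subst_mult ring_homomorphism_mpoly_const)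

lemma chart_expansion_scale:
  "chart_expansion j v (mpoly_scale c F) = mpoly_scale c (chart_expansion j v F)"
  unfolding mpoly_scale_def chart_expansion_mult
  by (simp add: chart_expansion_def mpoly_subst_const ring_homomorphism_mpoly_const)

lemma subspace_sections: "mpoly.subspace (sections d Z p q)"
proof (rule mpoly.subspaceI)
  show "0 \<in> sections d Z p q"
    by (simp add: sections_def vanishes_to_order_def chart_expansion_def)
  fix F G assume FG: "F \<in> sections d Z p q" "G \<in> sections d Z p q"
  then have "F + G \<in> forms d q" by (auto simp: sections_def intro: forms_add)
  moreover have "vanishes_to_order (F + G) n x" if "vanishes_to_order F n x" "vanishes_to_order G n x" for n x
    using that keys_add unfolding vanishes_to_order_def chart_expansion_add by fast
  ultimately show "F + G \<in> sections d Z p q" using FG by (auto simp: sections_def)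
next
  fix c F assume F: "F \<in> sections d Z p q"
  then have "mpoly_scale c F \<in> forms d q" by (auto simp: sections_def intro: forms_scale)
  moreover have "vanishes_to_order (mpoly_scale c F) n x" if "vanishes_to_order F n x" for n x
    using that unfolding vanishes_to_order_def chart_expansion_scale by (auto simp: in_keys_iff)
  ultimately show "mpoly_scale c F \<in> sections d Z p q" using F by (auto simp: sections_def)
qed


section \<open>The upper bound\<close>

lemma tail_sum_exponents:
  assumes "\<alpha> \<in> exponents d q" "i \<le> d"
  shows "(\<Sum>l<i. Poly_Mapping.lookup \<alpha> l) + (\<Sum>j=i..d. Poly_Mapping.lookup \<alpha> j) = q"
proof -
  have "{..d} = {..<i} \<union> {i..d}" using assms(2) by auto
  then have "(\<Sum>l\<le>d. Poly_Mapping.lookup \<alpha> l) = (\<Sum>l<i. Poly_Mapping.lookup \<alpha> l) + (\<Sum>j=i..d. Poly_Mapping.lookup \<alpha> j)"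
    by (simp add: sum.union_disjoint ivl_disj_int)
  then show ?thesis using assms(1) by (simp add: exponents_def)
qed

lemma tail_condition_iff:
  assumes "\<alpha> \<in> exponents d q" "i \<in> {1..d}"
  shows "int (\<Sum>j=i..d. Poly_Mapping.lookup \<alpha> j) \<le> int q - int (n::nat) \<longleftrightarrow> n \<le> (\<Sum>l<i. Poly_Mapping.lookup \<alpha> l)"
proof -
  have "int q = int (\<Sum>l<i. Poly_Mapping.lookup \<alpha> l) + int (\<Sum>j=i..d. Poly_Mapping.lookup \<alpha> j)"
    using tail_sum_exponents[of \<alpha> d q i] assms by (metis atLeastAtMost_iff of_nat_add)
  then show ?thesis by linarith
qed

lemma exponent_with_prefix:
  fixes \<alpha> :: "nat \<Rightarrow> nat"
  assumes "(\<Sum>l<d. \<alpha> l) \<le> q"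
  shows "\<exists>\<beta>\<in>exponents d q. \<forall>l<d. Poly_Mapping.lookup \<beta> l = \<alpha> l"
proof -
  define \<beta> where "\<beta> = (\<Sum>l\<le>d. Poly_Mapping.single l (if l < d then \<alpha> l else q - (\<Sum>l<d. \<alpha> l)))"
  have look: "Poly_Mapping.lookup \<beta> l = (if l < d then \<alpha> l else if l = d then q - (\<Sum>l<d. \<alpha> l) else 0)" for l
    by (auto simp: \<beta>_def lookup_single_combination)
  have "(\<Sum>l\<le>d. Poly_Mapping.lookup \<beta> l) = q"
    using assms by (simp add: lessThan_Suc_atMost[symmetric] look)
  moreover have "Poly_Mapping.keys \<beta> \<subseteq> {..d}" by (auto simp: in_keys_iff look split: if_splits)
  ultimately show ?thesis using look by (intro bexI[of _ \<beta>]) (auto simp: exponents_def)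
qed

text \<open>
  The order of vanishing is controlled at the normalised representative \<open>v / v j\<close> of the point;
  homogeneity carries the conclusion back to \<open>v\<close>.
\<close>

lemma hasse_seq_vanishes:
  fixes F :: "'k::field_char_0 mpoly"
  assumes F: "F \<in> forms d q" and x: "x \<in> proj_space d" "v \<in> x" and van: "vanishes_to_order F p x"
    and G: "hasse_seq e \<alpha> F s \<in> forms d n" and small: "(\<Sum>l<s. \<alpha> l) < p"
  shows "mpoly_eval (hasse_seq e \<alpha> F s) v = 0"
proof -
  obtain j where j: "v j \<noteq> 0" using proj_space_nonzero[OF x] by (auto simp: nonzero_vectors_def)
  let ?w = "\<lambda>i. v i / v j"
  have "order_on_lines ?w p F"
    using van x j by (intro order_on_lines_if_chart_order[of F d q v j, OF F j]) (auto simp: vanishes_to_order_def)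
  then have "mpoly_eval (hasse_seq e \<alpha> F s) ?w = 0"
    using order_on_lines_eval[OF hasse_seq_order_on_lines] small by (metis zero_less_diff)
  moreover have "v = (\<lambda>i. v j * ?w i)" using j by auto
  ultimately show ?thesis using eval_homogeneous[OF G, of "v j" ?w] by simp
qed

text \<open>
  The functionals indexed by the admissible exponents separate the sections: the leading exponent
  of a nonzero section \<open>F\<close> is admissible, since otherwise some \<open>hasse_seq e \<alpha> F i\<close> would vanish
  on a dense iterated join of \<open>Z i\<close>.
\<close>

lemma h0_upper_bound:
  fixes Z :: "nat \<Rightarrow> 'k::field_char_0 point set"
  assumes irr: "\<And>i. i \<in> {1..d} \<Longrightarrow> irreducible_subvariety d (Z i)"
    and codim: "\<And>i. i \<in> {1..d} \<Longrightarrow> codimension d (Z i) = enat i"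
  shows "h0 d Z p q \<le> card {\<alpha> \<in> exponents d q. \<forall>i\<in>{1..d}. p i \<le> (\<Sum>l<i. Poly_Mapping.lookup \<alpha> l)}"
proof -
  let ?A = "{\<alpha> \<in> exponents d q. \<forall>i\<in>{1..d}. p i \<le> (\<Sum>l<i. Poly_Mapping.lookup \<alpha> l)}"
  have Zp: "Z i \<subseteq> proj_space d" if "i \<in> {1..d}" for i
    using irr[OF that] by (auto simp: irreducible_subvariety_def zariski_closed_def zero_locus_def)
  have "\<forall>i\<in>{1..d}. \<exists>m. m \<le> d \<and> (\<exists>z\<in>\<Union>(Z i). z m \<noteq> 0)"
  proof
    fix i assume i: "i \<in> {1..d}"
    then have "Z i \<noteq> {}" using irr by (simp add: irreducible_subvariety_def)
    then obtain x where x: "x \<in> Z i" by blast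
    then obtain z where "z \<in> x" using Zp[OF i] proj_space_nonempty by blast
    moreover from this have "z \<in> nonzero_vectors d" using x Zp[OF i] proj_space_nonzero by blast
    ultimately show "\<exists>m. m \<le> d \<and> (\<exists>z\<in>\<Union>(Z i). z m \<noteq> 0)"
      using x by (auto simp: nonzero_vectors_def)
  qed
  then have "\<exists>m. \<forall>i\<in>{1..d}. m i \<le> d \<and> (\<exists>z\<in>\<Union>(Z i). z (m i) \<noteq> 0)"
    by (rule bchoice)
  then obtain m where m: "\<And>i. i \<in> {1..d} \<Longrightarrow> m i \<le> d \<and> (\<exists>z\<in>\<Union>(Z i). z (m i) \<noteq> 0)"
    by blast
  obtain e where "(\<forall>s\<le>d. supported d (e s)) \<and> (\<forall>s\<le>d. e s \<notin> vec.span (e ` {..<s})) \<and>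
    (\<forall>s\<le>d. \<forall>i\<in>{1..d}. \<forall>F n. F \<in> forms d n \<and> F \<noteq> 0 \<and>
       (\<forall>v\<in>iterated_join (m i) e (\<Union>(Z i)) s. mpoly_eval F v = 0) \<longrightarrow>
       (\<exists>F n. F \<in> forms d n \<and> (\<forall>v\<in>iterated_join (m i) e (\<Union>(Z i)) s. mpoly_eval F v = 0) \<and> mpoly_eval F (e s) \<noteq> 0))"
    using points_in_general_position[of "{1..d}" d m "\<lambda>i. \<Union>(Z i)", OF finite_atLeastAtMost] by (elim exE)
  then have e: "\<And>s. s \<le> d \<Longrightarrow> supported d (e s)" "\<And>s. s \<le> d \<Longrightarrow> e s \<notin> vec.span (e ` {..<s})"
    and avoid: "\<And>s i F n. s \<le> d \<Longrightarrow> i \<in> {1..d} \<Longrightarrow> F \<in> forms d n \<Longrightarrow> F \<noteq> 0 \<Longrightarrow>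
       \<forall>v\<in>iterated_join (m i) e (\<Union>(Z i)) s. mpoly_eval F v = 0 \<Longrightarrow>
       \<exists>F n. F \<in> forms d n \<and> (\<forall>v\<in>iterated_join (m i) e (\<Union>(Z i)) s. mpoly_eval F v = 0) \<and> mpoly_eval F (e s) \<noteq> 0"
    by meson+
  have dense: "F = 0" if i: "i \<in> {1..d}" and F: "F \<in> forms d n"
      "\<forall>v\<in>iterated_join (m i) e (\<Union>(Z i)) i. mpoly_eval F v = 0" for i F n
  proof -
    obtain z where "z \<in> \<Union>(Z i)" "z (m i) \<noteq> 0" using m[OF i] by blast
    then show ?thesis
      using i m[OF i] e(1) avoid F
      by (intro iterated_join_dense[OF irr[OF i] codim[OF i], of "m i" z e F n]) auto
  qed
  have "mpoly.dim (sections d Z p q) \<le> card ?A"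
  proof (rule dim_le_card_separating_functionals[OF subspace_sections,
        where f = "\<lambda>\<alpha> F. mpoly_eval (hasse_seq e (Poly_Mapping.lookup \<alpha>) F d) (e d)"])
    fix F assume F: "F \<in> sections d Z p q" "F \<noteq> 0"
    then have form: "F \<in> forms d q" by (simp add: sections_def)
    obtain \<alpha> where lead: "\<And>s. hasse_seq e \<alpha> F s \<in> forms d (q - (\<Sum>l<s. \<alpha> l))" "\<And>s. (\<Sum>l<s. \<alpha> l) \<le> q"
        "\<And>s. hasse_seq e \<alpha> F s \<noteq> 0" "\<And>s l. l < s \<Longrightarrow> translation_invariant (e l) (hasse_seq e \<alpha> F s)"
      using leading_exponent[OF form F(2), of e] by blast
    obtain \<beta> where \<beta>: "\<beta> \<in> exponents d q" "\<And>l. l < d \<Longrightarrow> Poly_Mapping.lookup \<beta> l = \<alpha> l"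
      using exponent_with_prefix[OF lead(2)] by blast
    have "p i \<le> (\<Sum>l<i. \<alpha> l)" if i: "i \<in> {1..d}" for i
    proof (rule ccontr)
      assume "\<not> ?thesis"
      then have "\<forall>v\<in>\<Union>(Z i). mpoly_eval (hasse_seq e \<alpha> F i) v = 0"
        using hasse_seq_vanishes[OF form _ _ _ lead(1)] F(1) i Zp[OF i] by (fastforce simp: sections_def)
      then have "hasse_seq e \<alpha> F i = 0"
        by (intro dense[OF i lead(1)] vanishes_on_iterated_join lead(4))
      then show False using lead(3) by simp
    qed
    then have "\<beta> \<in> ?A" using \<beta> by auto
    moreover have "mpoly_eval (hasse_seq e \<alpha> F d) (e d) \<noteq> 0"
      using span_of_vectors_in_general_position[OF e]
      by (intro invariant_form_nonzero_at_last[OF lead(1,3)] lead(4))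
    moreover have "hasse_seq e (Poly_Mapping.lookup \<beta>) F d = hasse_seq e \<alpha> F d"
      using \<beta>(2) by (rule hasse_seq_cong)
    ultimately show "\<exists>\<alpha>\<in>?A. mpoly_eval (hasse_seq e (Poly_Mapping.lookup \<alpha>) F d) (e d) \<noteq> 0"
      by (intro bexI[of _ \<beta>]) simp_all
  qed (simp_all add: finite_exponents hasse_seq_add hasse_seq_scale mpoly_eval_scale)
  then show ?thesis by (simp add: h0_def)
qed

section \<open>Equality for linear flags\<close>

lemma eval_cong_forms:
  assumes "F \<in> forms d n" "\<And>i. i \<le> d \<Longrightarrow> v i = w i"
  shows "mpoly_eval F v = mpoly_eval F w"
  unfolding mpoly_eval_def using assms
  by (intro mpoly_subst_cong_vars) (force simp: forms_def exponents_def)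

lemma eval_linear_form:
  fixes F :: "'k::field_char_0 mpoly"
  assumes F: "F \<in> forms d 1"
  shows "mpoly_eval F (\<lambda>i. x i + c * v i) = mpoly_eval F x + c * mpoly_eval F v"
proof -
  have high: "coeff (line F x v) a = 0" if "a > 1" for a x
    using eval_hasse[of v a F x] hasse_forms(2)[OF F that, of v] by simp
  have "line F x v = [:coeff (line F x v) 0, coeff (line F x v) 1:]" for x
    by (intro poly_eqI) (auto simp: coeff_pCons high split: nat.splits)
  then have expand: "mpoly_eval F (\<lambda>i. x i + c * v i) = coeff (line F x v) 0 + c * coeff (line F x v) 1" for x c
    using poly_line[of F x v c] by (metis (no_types, lifting) mult_zero_right add.right_neutral poly_0 poly_pCons)
  have const: "coeff (line F x v) 1 = coeff (line F (\<lambda>_. 0) v) 1" for x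
    using eval_homogeneous[of "hasse v 1 F" d 0 0 x] hasse_forms(1)[OF F, of v 1] by (simp add: eval_hasse)
  have "mpoly_eval F (\<lambda>_. 0) = 0" using eval_homogeneous[OF F, of 0 v] by simp
  then have "mpoly_eval F v = coeff (line F (\<lambda>_. 0) v) 1"
    using expand[of "\<lambda>_. 0" 1] expand[of "\<lambda>_. 0" 0] by simp
  then show ?thesis using expand[of x c] expand[of x 0] const[of x] by simp
qed

text \<open>
  With the convention \<open>Z 0 = \<P>\<^sup>d\<close>, the form \<open>l i\<close> is an equation of \<open>Z (i + 1)\<close> that does not
  vanish on \<open>Z i\<close>, and \<open>z i\<close> is a vector of \<open>Z i\<close> at which it does not vanish.  The last form
  \<open>l d\<close> is any coordinate that does not vanish on \<open>Z d\<close>.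
\<close>

lemma linear_flag_equations:
  fixes Z :: "nat \<Rightarrow> 'k::field_char_0 point set"
  assumes flag: "linear_flag d Z" and top: "1 \<le> d \<Longrightarrow> Z 1 \<noteq> proj_space d" and bottom: "1 \<le> d \<Longrightarrow> Z d \<noteq> {}"
  shows "\<exists>l z. \<forall>i\<le>d. l i \<in> forms d 1 \<and> mpoly_eval (l i) (z i) \<noteq> 0 \<and>
      (\<forall>j. i < j \<and> j \<le> d \<longrightarrow> (\<forall>v\<in>\<Union>(Z j). mpoly_eval (l i) v = 0) \<and> mpoly_eval (l i) (z j) = 0)"
proof -
  define W where "W i = (if i = 0 then proj_space d else Z i)" for i
  have lin: "\<exists>S. S \<subseteq> forms d 1 \<and> W i = zero_locus d S" if "0 < i" "i \<le> d" for i
    using flag that by (auto simp: linear_flag_def linear_subspace_def W_def)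
  have sub_proj: "W i \<subseteq> proj_space d" if "i \<le> d" for i
    using lin[of i] that by (cases "i = 0") (auto simp: W_def zero_locus_def)
  have strict: "W (Suc i) \<subset> W i" if "i < d" for i
  proof (cases "i = 0")
    case True
    then show ?thesis using sub_proj[of 1] top that by (auto simp: W_def)
  qed (use flag that in \<open>auto simp: linear_flag_def W_def\<close>)
  have mono: "W j \<subseteq> W i" if "i \<le> j" "j \<le> d" for i j
    using that by (induction j rule: dec_induct) (use strict in \<open>force simp: Suc_le_eq\<close>)+
  have "\<forall>i\<in>{..d}. \<exists>lz. fst lz \<in> forms d 1 \<and> snd lz \<in> \<Union>(W i) \<and> mpoly_eval (fst lz) (snd lz) \<noteq> 0 \<and>
      (\<forall>j. i < j \<and> j \<le> d \<longrightarrow> (\<forall>v\<in>\<Union>(W j). mpoly_eval (fst lz) v = 0))"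
  proof
    fix i assume i: "i \<in> {..d}"
    have "\<exists>l z. l \<in> forms d 1 \<and> z \<in> \<Union>(W i) \<and> mpoly_eval l z \<noteq> 0 \<and>
        (\<forall>j. i < j \<and> j \<le> d \<longrightarrow> (\<forall>v\<in>\<Union>(W j). mpoly_eval l v = 0))"
    proof (cases "i = d")
      case True
      have "(unit_vector 0 :: nat \<Rightarrow> 'k) \<in> nonzero_vectors d"
        by (rule nonzero_vectorsI[of _ _ 0]) (auto simp: supported_def unit_vector_def)
      then have "W d \<noteq> {}" using bottom proj_space_class(1) by (cases "d = 0") (fastforce simp: W_def)+
      then obtain x where x: "x \<in> W d" by blast
      then obtain z where "z \<in> x" "z \<in> nonzero_vectors d"
        using sub_proj[of d] proj_space_nonempty proj_space_nonzero by blast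
      then obtain k where "k \<le> d" "z k \<noteq> 0" by (auto simp: nonzero_vectors_def)
      then show ?thesis
        using \<open>z \<in> x\<close> x True forms_var[of k d] by (intro exI[of _ "mpoly_var k"] exI[of _ z]) auto
    next
      case False
      then have "i < d" using i by simp
      then obtain S where S: "S \<subseteq> forms d 1" "W (Suc i) = zero_locus d S" using lin[of "Suc i"] by auto
      obtain x where x: "x \<in> W i" "x \<notin> W (Suc i)" using strict[OF \<open>i < d\<close>] by auto
      then obtain l z where l: "l \<in> S" "z \<in> x" "mpoly_eval l z \<noteq> 0"
        using S(2) sub_proj[of i] i by (auto simp: zero_locus_def)
      have "mpoly_eval l v = 0" if "i < j" "j \<le> d" "v \<in> \<Union>(W j)" for j v
        using mono[of "Suc i" j] that S(2) l(1) by (auto simp: zero_locus_def)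
      then show ?thesis using l x(1) S(1) by (intro exI[of _ l] exI[of _ z]) auto
    qed
    then show "\<exists>lz. fst lz \<in> forms d 1 \<and> snd lz \<in> \<Union>(W i) \<and> mpoly_eval (fst lz) (snd lz) \<noteq> 0 \<and>
      (\<forall>j. i < j \<and> j \<le> d \<longrightarrow> (\<forall>v\<in>\<Union>(W j). mpoly_eval (fst lz) v = 0))"
      by simp
  qed
  then obtain lz where lz: "\<forall>i\<in>{..d}. fst (lz i) \<in> forms d 1 \<and> snd (lz i) \<in> \<Union>(W i) \<and>
      mpoly_eval (fst (lz i)) (snd (lz i)) \<noteq> 0 \<and>
      (\<forall>j. i < j \<and> j \<le> d \<longrightarrow> (\<forall>v\<in>\<Union>(W j). mpoly_eval (fst (lz i)) v = 0))"
    using bchoice by (metis (no_types, lifting))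
  have "mpoly_eval (fst (lz i)) (snd (lz j)) = 0" if "i < j" "j \<le> d" for i j
  proof -
    have "snd (lz j) \<in> \<Union>(W j)" "\<forall>v\<in>\<Union>(W j). mpoly_eval (fst (lz i)) v = 0" using lz that by simp_all
    then show ?thesis by blast
  qed
  moreover have "\<Union>(W j) = \<Union>(Z j)" if "i < j" for i j using that by (simp add: W_def)
  ultimately show ?thesis
    using lz by (intro exI[of _ "\<lambda>i. fst (lz i)"] exI[of _ "\<lambda>i. snd (lz i)"]) (simp add: W_def)
qed

text \<open>The values \<open>l j (z i)\<close> form a triangular matrix, so the equations are solved one by one.\<close>

lemma triangular_forms_surjective:
  fixes l :: "nat \<Rightarrow> 'k::field_char_0 mpoly"
  assumes l: "\<And>i. i \<le> d \<Longrightarrow> l i \<in> forms d 1" "\<And>i. i \<le> d \<Longrightarrow> mpoly_eval (l i) (z i) \<noteq> 0"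
    and tri: "\<And>i j. i < j \<Longrightarrow> j \<le> d \<Longrightarrow> mpoly_eval (l i) (z j) = 0"
  shows "\<exists>x. \<forall>i\<le>d. mpoly_eval (l i) x = y i"
proof -
  have "\<exists>x. \<forall>i<s. mpoly_eval (l i) x = y i" if "s \<le> Suc d" for s
    using that
  proof (induction s)
    case (Suc s)
    then obtain x where x: "\<And>i. i < s \<Longrightarrow> mpoly_eval (l i) x = y i" by auto
    define c where "c = (y s - mpoly_eval (l s) x) / mpoly_eval (l s) (z s)"
    have "mpoly_eval (l i) (\<lambda>k. x k + c * z s k) = y i" if "i < Suc s" for i
    proof -
      have "mpoly_eval (l i) (\<lambda>k. x k + c * z s k) = mpoly_eval (l i) x + c * mpoly_eval (l i) (z s)"
        using that Suc.prems by (intro eval_linear_form[of _ d] l) auto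
      then show ?thesis
        using that Suc.prems x tri[of i s] l(2)[of s] by (cases "i = s") (auto simp: c_def)
    qed
    then show ?case by blast
  qed simp
  from this[of "Suc d"] show ?thesis by (simp add: less_Suc_eq_le)
qed

lemma subst_injective_if_surjective:
  fixes l :: "nat \<Rightarrow> 'k::field_char_0 mpoly"
  assumes F: "F \<in> forms d n" "mpoly_subst mpoly_const l F = 0"
    and surj: "\<And>y. \<exists>x. \<forall>i\<le>d. mpoly_eval (l i) x = y i"
  shows "F = 0"
proof (rule form_eq_0I[OF F(1)])
  fix y
  obtain x where "\<forall>i\<le>d. mpoly_eval (l i) x = y i" using surj by blast
  then have "mpoly_eval F y = mpoly_eval F (\<lambda>i. mpoly_eval (l i) x)"
    by (intro eval_cong_forms[OF F(1)]) auto
  then show "mpoly_eval F y = 0"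
    using F(2) by (metis mpoly_eval_subst mpoly_eval_hom(1))
qed

lemma total_degree_add: "total_degree (m + n) = total_degree m + total_degree n"
proof -
  let ?S = "Poly_Mapping.keys m \<union> Poly_Mapping.keys n"
  have sup: "total_degree k = (\<Sum>i\<in>?S. Poly_Mapping.lookup k i)" if "Poly_Mapping.keys k \<subseteq> ?S" for k
    unfolding total_degree_def using that by (intro sum.mono_neutral_left) (auto simp: in_keys_iff)
  show ?thesis using keys_add[of m n] by (simp add: sup lookup_add sum.distrib)
qed

lemma grading_order_at_origin:
  "multiplicative_grading (\<lambda>n. {H :: 'k::comm_ring_1 mpoly. \<forall>m\<in>Poly_Mapping.keys H. n \<le> total_degree m})"
  unfolding multiplicative_grading_def
proof (intro conjI allI ballI)
  fix m n and F G :: "'k mpoly"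
  assume "F \<in> {H. \<forall>k\<in>Poly_Mapping.keys H. m \<le> total_degree k}" "G \<in> {H. \<forall>k\<in>Poly_Mapping.keys H. n \<le> total_degree k}"
  then show "F * G \<in> {H. \<forall>k\<in>Poly_Mapping.keys H. m + n \<le> total_degree k}"
    using keys_mult[of F G] by (fastforce simp: total_degree_add intro: add_mono)
next
  fix n and F G :: "'k mpoly"
  assume "F \<in> {H. \<forall>k\<in>Poly_Mapping.keys H. n \<le> total_degree k}" "G \<in> {H. \<forall>k\<in>Poly_Mapping.keys H. n \<le> total_degree k}"
  then show "F + G \<in> {H. \<forall>k\<in>Poly_Mapping.keys H. n \<le> total_degree k}"
    using keys_add[of F G] by auto
qed auto

lemma eval_at_origin: "mpoly_eval F (\<lambda>_. 0) = Poly_Mapping.lookup F 0"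
proof -
  have "monomial_value (\<lambda>_. 0 :: 'a) m = (if m = 0 then 1 else 0)" for m
  proof (cases "m = 0")
    case False
    then obtain i where "i \<in> Poly_Mapping.keys m" by (metis all_not_in_conv keys_eq_empty)
    then show ?thesis using False by (auto simp: monomial_value_def in_keys_iff power_0_left intro!: prod_zero bexI[of _ i])
  qed simp
  then have "mpoly_eval F (\<lambda>_. 0) = (\<Sum>m\<in>Poly_Mapping.keys F. if m = 0 then Poly_Mapping.lookup F 0 else 0)"
    unfolding mpoly_eval_def mpoly_subst_altdef by (intro sum.cong) auto
  then show ?thesis by (simp add: sum.delta in_keys_iff)
qed

text \<open>
  In a chart around the point, the expansions of \<open>l 0, \<dots>, l (k - 1)\<close> have no constant term, so
  each occurrence of one of them as a factor contributes one to the order of vanishing.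
\<close>

lemma monomial_in_linear_forms_vanishes:
  fixes l :: "nat \<Rightarrow> 'k::field mpoly"
  assumes \<alpha>: "\<alpha> \<in> exponents d q" and l: "\<And>i. i \<le> d \<Longrightarrow> l i \<in> forms d 1" and "k \<le> d"
    and van: "\<And>i v. i < k \<Longrightarrow> v \<in> x \<Longrightarrow> mpoly_eval (l i) v = 0"
    and p: "p \<le> (\<Sum>i<k. Poly_Mapping.lookup \<alpha> i)"
  shows "vanishes_to_order (monomial_value l \<alpha>) p x"
  unfolding vanishes_to_order_def
proof (intro ballI allI impI)
  fix v j m assume v: "v \<in> x" "v j \<noteq> 0" and m: "m \<in> Poly_Mapping.keys (chart_expansion j v (monomial_value l \<alpha>))"
  let ?\<sigma> = "\<lambda>i. chart_expansion j v (l i)"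
  let ?G = "\<lambda>n. {H :: 'k mpoly. \<forall>m\<in>Poly_Mapping.keys H. n \<le> total_degree m}"
  have "ring_homomorphism (chart_expansion j v)"
    unfolding chart_expansion_def[abs_def] by (rule ring_homomorphism_mpoly_subst[OF ring_homomorphism_mpoly_const])
  then have eq: "chart_expansion j v (monomial_value l \<alpha>) = monomial_value ?\<sigma> \<alpha>"
    by (simp add: monomial_value_def ring_homomorphism_prod ring_homomorphism_power)
  have "?\<sigma> i \<in> ?G (if i < k then 1 else 0)" if "i \<le> d" for i
  proof (cases "i < k")
    case True
    have "Poly_Mapping.lookup (?\<sigma> i) 0 = mpoly_eval (l i) (\<lambda>i. mpoly_eval (if i = j then 1 else mpoly_var i + mpoly_const (v i / v j)) (\<lambda>_. 0))"
      unfolding eval_at_origin[symmetric] chart_expansion_def mpoly_eval_subst ..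
    also have "\<dots> = mpoly_eval (l i) (\<lambda>i. inverse (v j) * v i)"
      using v(2) by (intro arg_cong[where f = "mpoly_eval (l i)"] ext) (simp add: field_simps)
    also have "\<dots> = 0" using eval_homogeneous[OF l[OF that]] van[OF True v(1)] by simp
    finally have "0 \<notin> Poly_Mapping.keys (?\<sigma> i)" by (simp add: in_keys_iff)
    moreover have "total_degree m > 0" if "m \<noteq> 0" for m
    proof -
      obtain i where "i \<in> Poly_Mapping.keys m" using \<open>m \<noteq> 0\<close> by (metis all_not_in_conv keys_eq_empty)
      then show ?thesis unfolding total_degree_def by (intro sum_pos2[of _ i]) (auto simp: in_keys_iff)
    qed
    ultimately show ?thesis using True by (auto simp: Suc_le_eq) metis
  qed simp
  then have "monomial_value ?\<sigma> \<alpha> \<in> ?G (\<Sum>i\<le>d. Poly_Mapping.lookup \<alpha> i * (if i < k then 1 else 0))"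
    by (rule grading_monomial_value[OF grading_order_at_origin \<alpha>])
  moreover have "(\<Sum>i\<le>d. Poly_Mapping.lookup \<alpha> i * (if i < k then 1 else 0)) = (\<Sum>i<k. Poly_Mapping.lookup \<alpha> i)"
    using \<open>k \<le> d\<close> by (intro sum.mono_neutral_cong_right) auto
  ultimately show "p \<le> total_degree m" using m p by (auto simp: eq)
qed

lemma subspace_forms: "mpoly.subspace (forms d q :: 'k::field mpoly set)"
  by (rule mpoly.subspaceI) (auto intro: forms_add forms_scale)

lemma independent_monomials:
  assumes "finite A"
  shows "mpoly.independent ((\<lambda>\<alpha>. Poly_Mapping.single \<alpha> (1::'k::field)) ` A)"
proof (rule mpoly.independent_if_scalars_zero)
  let ?s = "\<lambda>\<alpha>. Poly_Mapping.single \<alpha> (1::'k)"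
  have inj: "inj_on ?s A" by (rule inj_onI) (metis keys_single singleton_inject zero_neq_one)
  fix f :: "'k mpoly \<Rightarrow> 'k" and x
  assume sum: "(\<Sum>x\<in>?s ` A. mpoly_scale (f x) x) = 0" and "x \<in> ?s ` A"
  then obtain \<alpha> where \<alpha>: "\<alpha> \<in> A" "x = ?s \<alpha>" by auto
  have "mpoly_scale c (?s \<beta>) = Poly_Mapping.single \<beta> c" for c \<beta>
    by (rule poly_mapping_eqI) (simp add: lookup_single when_def)
  then have "(\<Sum>\<beta>\<in>A. Poly_Mapping.single \<beta> (f (?s \<beta>))) = 0"
    using sum by (simp add: sum.reindex[OF inj])
  then show "f x = 0" using lookup_single_combination[OF assms, of "\<lambda>\<beta>. f (?s \<beta>)" \<alpha>] \<alpha> by simp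
qed (use assms in simp)

text \<open>
  The admissible monomials, evaluated at the equations \<open>l\<close> of the flag, are sections.  They stay
  independent because \<open>x \<mapsto> (l 0 x, \<dots>, l d x)\<close> is onto, so that substituting \<open>l\<close> is injective on
  forms.
\<close>

lemma h0_flag_lower_bound:
  fixes Z :: "nat \<Rightarrow> 'k::field_char_0 point set"
  assumes flag: "linear_flag d Z" and top: "1 \<le> d \<Longrightarrow> Z 1 \<noteq> proj_space d" and bottom: "1 \<le> d \<Longrightarrow> Z d \<noteq> {}"
  shows "card {\<alpha> \<in> exponents d q. \<forall>i\<in>{1..d}. p i \<le> (\<Sum>l<i. Poly_Mapping.lookup \<alpha> l)} \<le> h0 d Z p q"
proof -
  interpret pair: vector_space_pair "mpoly_scale :: 'k \<Rightarrow> _" "mpoly_scale :: 'k \<Rightarrow> _"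
    by (rule vector_space_pair_mpoly)
  let ?A = "{\<alpha> \<in> exponents d q. \<forall>i\<in>{1..d}. p i \<le> (\<Sum>l<i. Poly_Mapping.lookup \<alpha> l)}"
  let ?s = "\<lambda>\<alpha>. Poly_Mapping.single \<alpha> (1::'k)"
  obtain l z where lz: "\<forall>i\<le>d. l i \<in> forms d 1 \<and> mpoly_eval (l i) (z i) \<noteq> 0 \<and>
      (\<forall>j. i < j \<and> j \<le> d \<longrightarrow> (\<forall>v\<in>\<Union>(Z j). mpoly_eval (l i) v = 0) \<and> mpoly_eval (l i) (z j) = 0)"
    using linear_flag_equations[OF flag top bottom] by blast
  have surj: "\<exists>x. \<forall>i\<le>d. mpoly_eval (l i) x = y i" for y
    using lz by (intro triangular_forms_surjective[where z = z]) auto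
  define \<phi> where "\<phi> = mpoly_subst mpoly_const l"
  have lin: "Vector_Spaces.linear mpoly_scale mpoly_scale \<phi>"
    unfolding Vector_Spaces.linear_iff using mpoly.vector_space_axioms
    by (simp add: \<phi>_def mpoly_scale_def mpoly_subst_add mpoly_subst_mult mpoly_subst_const ring_homomorphism_mpoly_const)
  have A: "finite ?A" "?A \<subseteq> exponents d q" by (auto simp: finite_exponents)
  have "?s ` ?A \<subseteq> forms d q" by (auto simp: forms_def)
  then have span: "mpoly.span (?s ` ?A) \<subseteq> forms d q" using subspace_forms by (rule mpoly.span_minimal)
  have inj: "inj_on \<phi> (mpoly.span (?s ` ?A))"
    using span subst_injective_if_surjective[OF _ _ surj]
    by (subst pair.linear_inj_on_iff_eq_0[OF lin]) (auto simp: \<phi>_def)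
  have "mpoly.independent (\<phi> ` ?s ` ?A)"
    by (rule pair.linear_independent_injective_image[OF lin independent_monomials[OF A(1)] inj])
  moreover have "\<phi> ` ?s ` ?A \<subseteq> sections d Z p q"
  proof (intro image_subsetI)
    fix F assume "F \<in> ?s ` ?A"
    then obtain \<alpha> where \<alpha>: "\<alpha> \<in> ?A" "F = ?s \<alpha>" by blast
    have "\<phi> F = monomial_value l \<alpha>"
      by (simp add: \<alpha> \<phi>_def mpoly_subst_single mpoly_const_def)
    moreover have "\<phi> F \<in> forms d q"
      unfolding \<phi>_def using \<alpha> lz by (intro subst_linear_in_forms) (auto simp: forms_def)
    moreover have "vanishes_to_order (monomial_value l \<alpha>) (p i) x" if "i \<in> {1..d}" "x \<in> Z i" for i x
      using \<alpha> lz that by (intro monomial_in_linear_forms_vanishes[where k = i and d = d and q = q]) auto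
    ultimately show "\<phi> F \<in> sections d Z p q" by (simp add: sections_def)
  qed
  ultimately have "card (\<phi> ` ?s ` ?A) \<le> mpoly.dim (sections d Z p q)"
    by (intro card_le_dim_forms[where d = d and q = q]) (auto simp: sections_def)
  moreover have "card (\<phi> ` ?s ` ?A) = card (?s ` ?A)"
    using inj by (intro card_image) (meson inj_on_subset mpoly.span_superset)
  moreover have "card (?s ` ?A) = card ?A"
    by (intro card_image inj_onI) (metis keys_single singleton_inject zero_neq_one)
  ultimately show ?thesis by (simp add: h0_def)
qed

lemma codimension_proj_space: "codimension d (proj_space d :: 'k::field point set) = 0"
proof -
  have "n = 0" if "Y 0 = proj_space d" "\<forall>i\<le>n. irreducible_subvariety d (Y i)" "\<forall>i<n. Y i \<subset> Y (Suc i)"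
    for n and Y :: "nat \<Rightarrow> 'k point set"
  proof (rule ccontr)
    assume "n \<noteq> 0"
    then have "proj_space d \<subset> Y 1" "irreducible_subvariety d (Y 1)" using that by auto
    then show False by (auto simp: irreducible_subvariety_def zariski_closed_def zero_locus_def)
  qed
  then have "codimension d (proj_space d :: 'k point set) \<le> 0"
    unfolding codimension_def by (intro SUP_least) (auto simp: zero_enat_def)
  then show ?thesis by simp
qed

theorem proposition1p7:
  fixes d q :: nat
    and p :: "nat \<Rightarrow> nat"
    and Z :: "nat \<Rightarrow> 'k::{alg_closed_field, field_char_0} point set"
  assumes "\<And>i. i \<in> {1..d} \<Longrightarrow> irreducible_subvariety d (Z i)"
    and "\<And>i. i \<in> {1..d} \<Longrightarrow> codimension d (Z i) = enat i"
  shows "h0 d Z p q \<le>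
           card {\<alpha> \<in> exponents d q.
                   \<forall>i\<in>{1..d}. int (\<Sum>j=i..d. Poly_Mapping.lookup \<alpha> j) \<le> int q - int (p i)}
         \<and>
         (linear_flag d Z \<longrightarrow>
            h0 d Z p q =
              card {\<alpha> \<in> exponents d q.
                      \<forall>i\<in>{1..d}. int (\<Sum>j=i..d. Poly_Mapping.lookup \<alpha> j) \<le> int q - int (p i)})"
proof -
  have A: "{\<alpha> \<in> exponents d q. \<forall>i\<in>{1..d}. int (\<Sum>j=i..d. Poly_Mapping.lookup \<alpha> j) \<le> int q - int (p i)}
      = {\<alpha> \<in> exponents d q. \<forall>i\<in>{1..d}. p i \<le> (\<Sum>l<i. Poly_Mapping.lookup \<alpha> l)}"
    using tail_condition_iff by blast
  have upper: "h0 d Z p q \<le> card {\<alpha> \<in> exponents d q. \<forall>i\<in>{1..d}. p i \<le> (\<Sum>l<i. Poly_Mapping.lookup \<alpha> l)}"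
    by (rule h0_upper_bound[OF assms])
  have "Z 1 \<noteq> proj_space d" if "1 \<le> d"
    using codimension_proj_space[where 'k = 'k] assms(2)[of 1] that by (auto simp: zero_enat_def)
  moreover have "Z d \<noteq> {}" if "1 \<le> d"
    using assms(1)[of d] that by (auto simp: irreducible_subvariety_def)
  ultimately have "card {\<alpha> \<in> exponents d q. \<forall>i\<in>{1..d}. p i \<le> (\<Sum>l<i. Poly_Mapping.lookup \<alpha> l)} \<le> h0 d Z p q"
    if "linear_flag d Z"
    using that by (intro h0_flag_lower_bound)
  then show ?thesis unfolding A using upper by auto
qed

end
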